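(* Let $H\in(\frac13,\frac12)$, $T>0$, $\sigma\in\mathbb{R}$ and $X_0\in\mathbb{R}$ (deterministic). Let $B=\{B_t\}_{t\in[0,T]}$ be a scalar fractional Brownian motion with Hurst parameter $H$ on a probability space $(\Omega,\mathcal{F},\mathbb{P})$. Assume that $a:\mathbb{R}\to\mathbb{R}$ has bounded derivatives up to order three (that is, $a',a'',a'''$ exist and are bounded; $a$ itself need not be bounded). Let $X$ be the solution of $$X_t=X_0+\int_0^t a(X_s)\,{\rm d}s+\sigma B_t,\qquad t\in[0,T].$$ For $n\in\mathbb{N}_+$ put $h=\frac Tn$, $t_k=kh$ ($k=0,\dots,n$), and let $Y$ (depending on $n$) be the continuously interpolated Euler scheme defined by $Y_0=X_0$ and $$Y_t=Y_{t_k}+a(Y_{t_k})(t-t_k)+\sigma(B_t-B_{t_k}),\qquad t\in(t_k,t_{k+1}],\ k=0,\dots,n-1.$$ Then there is a constant $C$, independent of $n$ (equivalently of $h$), such that for every $n\in\mathbb{N}_+$ $$\Big(\sup_{t\in[0,T]}\mathbb{E}|X_t-Y_t|^2\Big)^{1/2}\le C h^{2H}.$$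
   Context: A scalar fractional Brownian motion with Hurst parameter $H\in(0,1)$ is a continuous centered Gaussian process $B=\{B_t\}_{t\in[0,T]}$ with $B_0=0$ almost surely and covariance $\mathbb{E}[B_sB_t]=\frac12\big(t^{2H}+s^{2H}-|t-s|^{2H}\big)$ for $s,t\in[0,T]$. The noise is additive, so the equation ${\rm d}X_t=a(X_t)\,{\rm d}t+\sigma\,{\rm d}B_t$ is understood pathwise as the integral equation in the claim. $C$ denotes a generic constant that may depend on $H,T,\sigma,X_0,a$ but not on $n$. *)

theory Defs
  imports "HOL-Probability.Probability"
begin

text \<open>The second disjunct is the degenerate normal law of variance zero, which a Gaussian process
  may have as a marginal (for instance \<open>B 0\<close> below).\<close>

definition gaussian_rv :: "'w measure \<Rightarrow> ('w \<Rightarrow> real) \<Rightarrow> bool" where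
  "gaussian_rv M Z \<longleftrightarrow> Z \<in> borel_measurable M \<and>
     (\<exists>\<mu>. (\<exists>s>0. distributed M lborel Z (\<lambda>x. ennreal (normal_density \<mu> s x))) \<or>
          (AE \<omega> in M. Z \<omega> = \<mu>))"

text \<open>All finite-dimensional distributions are (possibly degenerate) multivariate normal,
  i.e. every finite linear combination of the marginals is normal.\<close>

definition gaussian_process :: "'w measure \<Rightarrow> real set \<Rightarrow> (real \<Rightarrow> 'w \<Rightarrow> real) \<Rightarrow> bool" where
  "gaussian_process M I B \<longleftrightarrow>
     (\<forall>J c. finite J \<and> J \<subseteq> I \<longrightarrow> gaussian_rv M (\<lambda>\<omega>. \<Sum>t\<in>J. c t * B t \<omega>))"

definition fractional_brownian_motion ::
    "'w measure \<Rightarrow> real \<Rightarrow> real \<Rightarrow> (real \<Rightarrow> 'w \<Rightarrow> real) \<Rightarrow> bool" where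
  "fractional_brownian_motion M H T B \<longleftrightarrow>
     gaussian_process M {0..T} B \<and>
     (AE \<omega> in M. continuous_on {0..T} (\<lambda>t. B t \<omega>)) \<and>
     (AE \<omega> in M. B 0 \<omega> = 0) \<and>
     (\<forall>t\<in>{0..T}. (LINT \<omega>|M. B t \<omega>) = 0) \<and>
     (\<forall>s\<in>{0..T}. \<forall>t\<in>{0..T}. (LINT \<omega>|M. B s \<omega> * B t \<omega>) =
        1 / 2 * (t powr (2 * H) + s powr (2 * H) - \<bar>t - s\<bar> powr (2 * H)))"

text \<open>The derivatives of orders \<open>1, \<dots>, m\<close> exist everywhere and are bounded; the function itself
  may be unbounded. Differentiability is required explicitly because \<open>deriv\<close> is total.\<close>

definition bounded_derivs :: "nat \<Rightarrow> (real \<Rightarrow> real) \<Rightarrow> bool" where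
  "bounded_derivs m a \<longleftrightarrow>
     (\<forall>k<m. (\<forall>x. (deriv ^^ k) a field_differentiable at x) \<and>
            bounded (range ((deriv ^^ Suc k) a)))"

text \<open>The path condition makes the integrand continuous, so the gauge integral used here is the
  Riemann integral.\<close>

definition sde_solution ::
    "'w measure \<Rightarrow> (real \<Rightarrow> real) \<Rightarrow> real \<Rightarrow> real \<Rightarrow> real \<Rightarrow>
     (real \<Rightarrow> 'w \<Rightarrow> real) \<Rightarrow> (real \<Rightarrow> 'w \<Rightarrow> real) \<Rightarrow> bool" where
  "sde_solution M a \<sigma> x0 T B X \<longleftrightarrow>
     (\<forall>t\<in>{0..T}. X t \<in> borel_measurable M) \<and>
     (AE \<omega> in M. continuous_on {0..T} (\<lambda>t. X t \<omega>) \<and>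
        (\<forall>t\<in>{0..T}. X t \<omega> = x0 + integral {0..t} (\<lambda>s. a (X s \<omega>)) + \<sigma> * B t \<omega>))"

text \<open>This determines \<open>Y\<close> on \<open>[0, T]\<close> uniquely, by recursion over the grid \<open>t\<^sub>k = k T / n\<close>.\<close>

definition euler_scheme ::
    "'w measure \<Rightarrow> (real \<Rightarrow> real) \<Rightarrow> real \<Rightarrow> real \<Rightarrow> real \<Rightarrow> nat \<Rightarrow>
     (real \<Rightarrow> 'w \<Rightarrow> real) \<Rightarrow> (real \<Rightarrow> 'w \<Rightarrow> real) \<Rightarrow> bool" where
  "euler_scheme M a \<sigma> x0 T n B Y \<longleftrightarrow>
     (let h = T / real n; \<tau> = (\<lambda>k. real k * h) in
        \<forall>\<omega>\<in>space M. Y 0 \<omega> = x0 \<and>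
          (\<forall>k<n. \<forall>t\<in>{\<tau> k<..\<tau> (Suc k)}.
             Y t \<omega> = Y (\<tau> k) \<omega> + a (Y (\<tau> k) \<omega>) * (t - \<tau> k) + \<sigma> * (B t \<omega> - B (\<tau> k) \<omega>)))"

end

theory Submission
  imports Defs
begin

text \<open>The one-step errors of the Euler scheme are, to leading order,
  \<open>\<sigma> a'(X\<^bsub>t\<^sub>k\<^esub>) \<integral> (B\<^sub>s - B\<^bsub>t\<^sub>k\<^esub>) ds\<close>, and everything else is \<open>O(h\<^bsup>2H\<^esup>)\<close> by Taylor expansion.
  For fixed \<open>r \<le> h\<close> the increments \<open>B(t\<^sub>k + r) - B(t\<^sub>k)\<close> are negatively correlated, so the sum of \<open>m\<close>
  consecutive ones is Gaussian of size \<open>m\<^bsup>1/2\<^esup> h\<^sup>H\<close>, while the weights \<open>a'(X\<^bsub>t\<^sub>k\<^esub>)\<close> vary by \<open>(m h)\<^sup>H\<close>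
  over \<open>m\<close> steps. A dyadic summation by parts then bounds the weighted sum in \<open>L\<^sup>2\<close>: since
  \<open>H + 1/2 < 1\<close>, the finest scale dominates and gives \<open>n h\<^bsup>2H\<^esup> = T h\<^bsup>2H-1\<^esup>\<close>. Integrating over
  \<open>r \<in> [0, h]\<close> and the discrete Gronwall inequality finish the proof.\<close>

section \<open>Moment bounds\<close>

text \<open>The obstacle is the gap between h^H and h^(2H): each local error has norm of order
  h^(1+H), so adding up norms over T/h steps yields only h^H, and the missing factor must come from
  cancellation between different steps. The probabilistic input is reduced to two facts: the sign of
  the covariance of disjoint increments, and the control of Gaussian fourth moments by the variance.
  Fourth moments enter because the L2 norm of a weight increment times a noise sum is split by
  Cauchy-Schwarz. A second constraint is uniformity: C is chosen before the probability space, the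
  processes and n. All constants are therefore explicit terms in the coefficients, and every
  estimate carries its constant along.\<close>

text \<open>An upper \<open>L\<^sup>p\<close> norm: \<open>f\<close> need not be measurable, which matters because pathwise integrals are
  only controlled almost everywhere.\<close>

definition moment_le :: "'w measure \<Rightarrow> nat \<Rightarrow> real \<Rightarrow> ('w \<Rightarrow> real) \<Rightarrow> bool" where
  "moment_le M p K f \<longleftrightarrow> 0 \<le> K \<and>
     (\<exists>D\<in>borel_measurable M. (AE \<omega> in M. ennreal (\<bar>f \<omega>\<bar> ^ p) \<le> D \<omega>) \<and>
        (\<integral>\<^sup>+\<omega>. D \<omega> \<partial>M) \<le> ennreal (K ^ p))"

lemma moment_le_nonneg: "moment_le M p K f \<Longrightarrow> 0 \<le> K"
  by (simp add: moment_le_def)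

text \<open>The common source of the closure rules below. The exponents p and q are kept apart so
  that fourth-moment hypotheses can give a second-moment conclusion, as for squares and
  products.\<close>

lemma moment_le_lincomb:
  assumes f: "moment_le M q K1 f" and g: "moment_le M q K2 g"
    and c: "0 \<le> c1" "0 \<le> c2" and K: "0 \<le> K"
    and le: "AE \<omega> in M. \<bar>F \<omega>\<bar> ^ p \<le> c1 * \<bar>f \<omega>\<bar> ^ q + c2 * \<bar>g \<omega>\<bar> ^ q"
    and bnd: "c1 * K1 ^ q + c2 * K2 ^ q \<le> K ^ p"
  shows "moment_le M p K F"
proof -
  obtain D1 where D1: "D1 \<in> borel_measurable M" "AE \<omega> in M. ennreal (\<bar>f \<omega>\<bar> ^ q) \<le> D1 \<omega>"
    "(\<integral>\<^sup>+\<omega>. D1 \<omega> \<partial>M) \<le> ennreal (K1 ^ q)" and K1: "0 \<le> K1"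
    using f by (auto simp: moment_le_def)
  obtain D2 where D2: "D2 \<in> borel_measurable M" "AE \<omega> in M. ennreal (\<bar>g \<omega>\<bar> ^ q) \<le> D2 \<omega>"
    "(\<integral>\<^sup>+\<omega>. D2 \<omega> \<partial>M) \<le> ennreal (K2 ^ q)" and K2: "0 \<le> K2"
    using g by (auto simp: moment_le_def)
  note [measurable] = D1(1) D2(1)
  let ?D = "\<lambda>\<omega>. ennreal c1 * D1 \<omega> + ennreal c2 * D2 \<omega>"
  have "AE \<omega> in M. ennreal (\<bar>F \<omega>\<bar> ^ p) \<le> ?D \<omega>"
    using le D1(2) D2(2)
  proof eventually_elim
    case (elim \<omega>)
    have "ennreal (\<bar>F \<omega>\<bar> ^ p) \<le> ennreal (c1 * \<bar>f \<omega>\<bar> ^ q + c2 * \<bar>g \<omega>\<bar> ^ q)"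
      using elim(1) by (rule ennreal_leI)
    also have "\<dots> = ennreal c1 * ennreal (\<bar>f \<omega>\<bar> ^ q) + ennreal c2 * ennreal (\<bar>g \<omega>\<bar> ^ q)"
      using c by (simp add: ennreal_plus ennreal_mult)
    also have "\<dots> \<le> ?D \<omega>"
      using elim by (intro add_mono mult_left_mono) auto
    finally show ?case .
  qed
  moreover have "(\<integral>\<^sup>+\<omega>. ?D \<omega> \<partial>M) \<le> ennreal (K ^ p)"
  proof -
    have "(\<integral>\<^sup>+\<omega>. ?D \<omega> \<partial>M) = ennreal c1 * (\<integral>\<^sup>+\<omega>. D1 \<omega> \<partial>M) + ennreal c2 * (\<integral>\<^sup>+\<omega>. D2 \<omega> \<partial>M)"
      by (simp add: nn_integral_add nn_integral_cmult)
    also have "\<dots> \<le> ennreal c1 * ennreal (K1 ^ q) + ennreal c2 * ennreal (K2 ^ q)"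
      using D1(3) D2(3) by (intro add_mono mult_left_mono) auto
    also have "\<dots> = ennreal (c1 * K1 ^ q + c2 * K2 ^ q)"
      using c K1 K2 by (simp add: ennreal_plus ennreal_mult)
    also have "\<dots> \<le> ennreal (K ^ p)"
      using bnd by (rule ennreal_leI)
    finally show ?thesis .
  qed
  moreover have "?D \<in> borel_measurable M" by measurable
  ultimately show ?thesis
    using K by (auto simp: moment_le_def)
qed

lemma moment_le_mono_AE:
  assumes "moment_le M p K g" and "AE \<omega> in M. \<bar>f \<omega>\<bar> \<le> \<bar>g \<omega>\<bar>" and "K \<le> K'"
  shows "moment_le M p K' f"
proof (rule moment_le_lincomb[OF assms(1) assms(1), of 1 0])
  show "AE \<omega> in M. \<bar>f \<omega>\<bar> ^ p \<le> 1 * \<bar>g \<omega>\<bar> ^ p + 0 * \<bar>g \<omega>\<bar> ^ p"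
    using assms(2) by eventually_elim (simp add: power_mono)
qed (use assms moment_le_nonneg[OF assms(1)] in \<open>auto intro: power_mono\<close>)

lemma moment_le_mono: "moment_le M p K f \<Longrightarrow> K \<le> K' \<Longrightarrow> moment_le M p K' f"
  by (rule moment_le_mono_AE) auto

lemma moment_le_const: "prob_space M \<Longrightarrow> moment_le M p \<bar>c\<bar> (\<lambda>_. c)"
  unfolding moment_le_def
  by (intro conjI bexI[of _ "\<lambda>_. ennreal (\<bar>c\<bar> ^ p)"]) (auto simp: prob_space.emeasure_space_1)

lemma moment_le_cmult: "moment_le M p K f \<Longrightarrow> moment_le M p (\<bar>c\<bar> * K) (\<lambda>\<omega>. c * f \<omega>)"
  by (rule moment_le_lincomb[of M p K f K f "\<bar>c\<bar> ^ p" 0])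
     (auto simp: power_mult_distrib abs_mult dest: moment_le_nonneg)

lemma moment_le_abs: "moment_le M p K f \<Longrightarrow> moment_le M p K (\<lambda>\<omega>. \<bar>f \<omega>\<bar>)"
  by (erule moment_le_mono_AE) auto

lemma moment_le_square: "moment_le M 4 K f \<Longrightarrow> moment_le M 2 (K\<^sup>2) (\<lambda>\<omega>. (f \<omega>)\<^sup>2)"
  by (rule moment_le_lincomb[of M 4 K f K f 1 0]) (auto simp flip: power_mult)

text \<open>The inequalities for sums and products below use weights that divide by the bounds
  \<open>K1\<close> and \<open>K2\<close>; this settles the degenerate case in which one of them is
  0.\<close>

lemma moment_le_zero_AE:
  assumes "moment_le M p 0 f" "0 < p"
  shows "AE \<omega> in M. f \<omega> = 0"
proof -
  obtain D where D: "D \<in> borel_measurable M" "AE \<omega> in M. ennreal (\<bar>f \<omega>\<bar> ^ p) \<le> D \<omega>"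
    "(\<integral>\<^sup>+\<omega>. D \<omega> \<partial>M) = 0"
    using assms by (auto simp: moment_le_def zero_power)
  have "AE \<omega> in M. D \<omega> = 0"
    using D nn_integral_0_iff_AE by blast
  with D(2) show ?thesis
  proof eventually_elim
    case (elim \<omega>)
    then have "\<bar>f \<omega>\<bar> ^ p \<le> 0" by (simp add: ennreal_eq_0_iff)
    then have "\<bar>f \<omega>\<bar> ^ p = 0" by (intro antisym) auto
    then show ?case by simp
  qed
qed

lemma moment_le_zero:
  assumes "AE \<omega> in M. f \<omega> = 0" "0 \<le> K" "0 < p"
  shows "moment_le M p K f"
  unfolding moment_le_def using assms
  by (intro conjI bexI[of _ "\<lambda>_. 0"]) (auto simp: zero_power)

text \<open>Convexity of the p-th power at the points x/u and y/v with weights u/(u+v) and v/(u+v),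
  multiplied by (u+v)^p. The free parameters u and v are later set to the norms of the two
  summands.\<close>

lemma power_even_convex:
  fixes x y u v :: real
  assumes "even p" "0 < u" "0 < v"
  shows "(x + y) ^ p \<le> (u + v) ^ p * (u / (u + v)) / u ^ p * x ^ p + (u + v) ^ p * (v / (u + v)) / v ^ p * y ^ p"
proof -
  have 1: "u / (u + v) + v / (u + v) = 1"
    using assms by (simp flip: add_divide_distrib)
  have "(u / (u + v) * (x / u) + v / (u + v) * (y / v)) ^ p
      \<le> u / (u + v) * (x / u) ^ p + v / (u + v) * (y / v) ^ p"
    using convex_onD[OF convex_power_even[OF assms(1)], of "v / (u + v)" "x / u" "y / v"] assms 1
    by (smt (verit) UNIV_I divide_nonneg_pos real_scaleR_def)
  then have "(u + v) ^ p * (u / (u + v) * (x / u) + v / (u + v) * (y / v)) ^ p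
      \<le> (u + v) ^ p * (u / (u + v) * (x / u) ^ p + v / (u + v) * (y / v) ^ p)"
    using assms by (intro mult_left_mono) auto
  moreover have "(u + v) * (u / (u + v) * (x / u) + v / (u + v) * (y / v)) = x + y"
    using assms by (simp add: add_divide_distrib[symmetric])
  ultimately show ?thesis
    by (simp add: power_mult_distrib[symmetric]) (simp add: power_divide algebra_simps)
qed

text \<open>Minkowski's inequality. With u = \<open>K1\<close> and v = \<open>K2\<close> the two
  terms of the convexity bound integrate to the fractions K1/(K1+K2) and K2/(K1+K2) of
  (K1+K2)^p.\<close>

lemma moment_le_add:
  assumes f: "moment_le M p K1 f" and g: "moment_le M p K2 g" and p: "even p" "0 < p"
  shows "moment_le M p (K1 + K2) (\<lambda>\<omega>. f \<omega> + g \<omega>)"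
proof -
  note K = moment_le_nonneg[OF f] moment_le_nonneg[OF g]
  consider "K1 = 0" | "K2 = 0" | "0 < K1" "0 < K2" using K by linarith
  then show ?thesis
  proof cases
    case 1
    with moment_le_zero_AE[of M p f] f p have "AE \<omega> in M. f \<omega> = 0" by simp
    then show ?thesis
      by (intro moment_le_mono_AE[OF g]) (use 1 in auto)
  next
    case 2
    with moment_le_zero_AE[of M p g] g p have "AE \<omega> in M. g \<omega> = 0" by simp
    then show ?thesis
      by (intro moment_le_mono_AE[OF f]) (use 2 in auto)
  next
    case 3
    show ?thesis
    proof (rule moment_le_lincomb[OF f g])
      show "AE \<omega> in M. \<bar>f \<omega> + g \<omega>\<bar> ^ p \<le>
          (K1 + K2) ^ p * (K1 / (K1 + K2)) / K1 ^ p * \<bar>f \<omega>\<bar> ^ p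
          + (K1 + K2) ^ p * (K2 / (K1 + K2)) / K2 ^ p * \<bar>g \<omega>\<bar> ^ p"
        using power_even_convex[OF p(1) 3] p(1) by (simp add: power_even_abs)
      have "(K1 + K2) ^ p * (K1 / (K1 + K2)) / K1 ^ p * K1 ^ p
          + (K1 + K2) ^ p * (K2 / (K1 + K2)) / K2 ^ p * K2 ^ p
          = (K1 + K2) ^ p * (K1 / (K1 + K2) + K2 / (K1 + K2))"
        using 3 by (simp add: distrib_left)
      also have "\<dots> = (K1 + K2) ^ p"
        using 3 by (simp flip: add_divide_distrib)
      finally show "(K1 + K2) ^ p * (K1 / (K1 + K2)) / K1 ^ p * K1 ^ p
          + (K1 + K2) ^ p * (K2 / (K1 + K2)) / K2 ^ p * K2 ^ p \<le> (K1 + K2) ^ p"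
        by simp
    qed (use 3 in auto)
  qed
qed

lemma moment_le_sum:
  assumes "finite A" "\<And>i. i \<in> A \<Longrightarrow> moment_le M p (K i) (f i)" "even p" "0 < p"
  shows "moment_le M p (\<Sum>i\<in>A. K i) (\<lambda>\<omega>. \<Sum>i\<in>A. f i \<omega>)"
  using assms
proof (induction A rule: finite_induct)
  case empty
  then show ?case by (simp add: moment_le_zero)
next
  case (insert x F)
  then show ?case by (simp add: moment_le_add)
qed

text \<open>Cauchy--Schwarz, through \<open>2 x\<^sup>2 y\<^sup>2 \<le> \<lambda> x\<^sup>4 + \<lambda>\<^sup>-\<^sup>1 y\<^sup>4\<close> with \<open>\<lambda> = K2\<^sup>2 / K1\<^sup>2\<close>.\<close>

lemma moment_le_mult:
  assumes f: "moment_le M 4 K1 f" and g: "moment_le M 4 K2 g"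
  shows "moment_le M 2 (K1 * K2) (\<lambda>\<omega>. f \<omega> * g \<omega>)"
proof -
  note K = moment_le_nonneg[OF f] moment_le_nonneg[OF g]
  consider "K1 = 0" | "K2 = 0" | "0 < K1" "0 < K2" using K by linarith
  then show ?thesis
  proof cases
    case 1
    with moment_le_zero_AE[of M 4 f] f have "AE \<omega> in M. f \<omega> = 0" by simp
    then show ?thesis
      by (intro moment_le_zero) (use 1 in auto)
  next
    case 2
    with moment_le_zero_AE[of M 4 g] g have "AE \<omega> in M. g \<omega> = 0" by simp
    then show ?thesis
      by (intro moment_le_zero) (use 2 in auto)
  next
    case 3
    have pt: "\<bar>x * y\<bar>\<^sup>2 \<le> K2\<^sup>2 / (2 * K1\<^sup>2) * \<bar>x\<bar> ^ 4 + K1\<^sup>2 / (2 * K2\<^sup>2) * \<bar>y\<bar> ^ 4" for x y :: real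
    proof -
      have "0 \<le> (K2 / K1 * x\<^sup>2 - K1 / K2 * y\<^sup>2)\<^sup>2" by simp
      also have "\<dots> = K2\<^sup>2 / K1\<^sup>2 * x ^ 4 + K1\<^sup>2 / K2\<^sup>2 * y ^ 4 - 2 * (x * y)\<^sup>2"
        using 3 by (simp add: power2_diff power_mult_distrib power_divide flip: power_mult)
      finally show ?thesis by (simp add: power_even_abs)
    qed
    show ?thesis
      by (rule moment_le_lincomb[OF f g, of "K2\<^sup>2 / (2 * K1\<^sup>2)" "K1\<^sup>2 / (2 * K2\<^sup>2)"])
         (use 3 pt in \<open>auto simp: power_mult_distrib power4_eq_xxxx power2_eq_square\<close>)
  qed
qed

lemma moment_le_4_imp_2: "prob_space M \<Longrightarrow> moment_le M 4 K f \<Longrightarrow> moment_le M 2 K f"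
  using moment_le_mult[of M K f 1 "\<lambda>_. 1"] moment_le_const[of M 4 1] by simp

lemma moment_le_2D:
  assumes f: "moment_le M 2 K f" and [measurable]: "f \<in> borel_measurable M"
  shows "integrable M (\<lambda>\<omega>. \<bar>f \<omega>\<bar>\<^sup>2)" and "(LINT \<omega>|M. \<bar>f \<omega>\<bar>\<^sup>2) \<le> K\<^sup>2"
proof -
  obtain D where D: "AE \<omega> in M. ennreal (\<bar>f \<omega>\<bar>\<^sup>2) \<le> D \<omega>" "(\<integral>\<^sup>+\<omega>. D \<omega> \<partial>M) \<le> ennreal (K\<^sup>2)"
    using f by (auto simp: moment_le_def)
  have le: "(\<integral>\<^sup>+\<omega>. ennreal (\<bar>f \<omega>\<bar>\<^sup>2) \<partial>M) \<le> ennreal (K\<^sup>2)"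
    using nn_integral_mono_AE[OF D(1)] D(2) by (rule order_trans)
  then show int: "integrable M (\<lambda>\<omega>. \<bar>f \<omega>\<bar>\<^sup>2)"
    by (intro integrableI_bounded) (auto simp: order_le_less_trans)
  show "(LINT \<omega>|M. \<bar>f \<omega>\<bar>\<^sup>2) \<le> K\<^sup>2"
    using le nn_integral_eq_integral[OF int] by simp
qed

section \<open>Moments of integrals over time\<close>

text \<open>Uniform continuity bounds the error on each mesh cell by \<open>e'\<close> times the
  mesh size; an induction over the cells adds these errors up to
  \<open>e' * (b - a)\<close>.\<close>

lemma Riemann_sum_tendsto_integral:
  fixes f :: "real \<Rightarrow> real"
  assumes ab: "a \<le> b" and f: "continuous_on {a..b} f"
  shows "(\<lambda>N. \<Sum>i<Suc N. (b - a) / real (Suc N) * f (a + real i * ((b - a) / real (Suc N))))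
           \<longlonglongrightarrow> integral {a..b} f"
proof (rule LIMSEQ_I)
  fix e :: real assume e: "0 < e"
  \<comment> \<open>The added 1 keeps the denominator positive when a = b.\<close>
  define e' where "e' = e / (2 * (b - a + 1))"
  have e': "0 < e'" "e' * (b - a) < e"
  proof -
    have "e * (b - a) < e * (2 * (b - a + 1))"
      using e ab by (intro mult_strict_left_mono) auto
    then show "e' * (b - a) < e"
      using ab by (simp add: e'_def divide_less_eq)
    show "0 < e'" using e ab by (simp add: e'_def)
  qed
  have "uniformly_continuous_on {a..b} f"
    using f by (simp add: compact_uniformly_continuous)
  then obtain d where d: "0 < d" "\<And>x y. x \<in> {a..b} \<Longrightarrow> y \<in> {a..b} \<Longrightarrow> \<bar>x - y\<bar> < d \<Longrightarrow> \<bar>f x - f y\<bar> < e'"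
    using e' unfolding uniformly_continuous_on_def dist_real_def by metis
  obtain N0 :: nat where N0: "(b - a) / d < real N0" using reals_Archimedean2 by blast
  show "\<exists>no. \<forall>N\<ge>no. norm ((\<Sum>i<Suc N. (b - a) / real (Suc N) * f (a + real i * ((b - a) / real (Suc N))))
      - integral {a..b} f) < e"
  proof (intro exI allI impI)
    fix N assume N: "N0 \<le> N"
    define \<delta> where "\<delta> = (b - a) / real (Suc N)"
    have \<delta>: "0 \<le> \<delta>" "real (Suc N) * \<delta> = b - a" using ab by (auto simp: \<delta>_def)
    have "b - a < d * real (Suc N)"
      using N N0 d(1) by (smt (verit) mult.commute of_nat_Suc of_nat_mono pos_divide_less_eq mult_less_cancel_left)
    then have "\<delta> < d" by (simp add: \<delta>_def divide_less_eq)
    have in_ab: "a + real k * \<delta> \<in> {a..b}" if "k \<le> Suc N" for k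
      using \<delta> mult_right_mono[of "real k" "real (Suc N)" \<delta>] that by auto
    have "\<bar>(\<Sum>i<k. \<delta> * f (a + real i * \<delta>)) - integral {a..a + real k * \<delta>} f\<bar> \<le> e' * (real k * \<delta>)"
      if "k \<le> Suc N" for k
      using that
    proof (induction k)
      case (Suc k)
      let ?u = "a + real k * \<delta>" and ?v = "a + real (Suc k) * \<delta>"
      have uv: "a \<le> ?u" "?u \<le> ?v" "?v \<le> b" "?v - ?u = \<delta>"
        using in_ab[of k] in_ab[of "Suc k"] Suc.prems \<delta>(1) by (auto simp: algebra_simps)
      have int: "f integrable_on {x..y}" if "a \<le> x" "y \<le> b" for x y
        using that by (intro integrable_continuous_real continuous_on_subset[OF f]) auto
      have "integral {a..?u} f + integral {?u..?v} f = integral {a..?v} f"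
        using uv by (intro Henstock_Kurzweil_Integration.integral_combine int) auto
      moreover have "\<bar>integral {?u..?v} f - \<delta> * f ?u\<bar> \<le> e' * \<delta>"
      proof -
        have "((\<lambda>x. f x - f ?u) has_integral (integral {?u..?v} f - (?v - ?u) * f ?u)) {?u..?v}"
          using has_integral_diff[OF integrable_integral[OF int[of ?u ?v]] has_integral_const_real[of "f ?u" ?u ?v]] uv
          by (simp add: content_real)
        then have "norm (integral {?u..?v} f - (?v - ?u) * f ?u) \<le> e' * measure lborel {?u..?v}"
        proof (rule has_integral_bound_real[where S="{}", rotated 2])
          fix x assume "x \<in> {?u..?v} - {}"
          then have "?u \<le> x" "x \<le> ?v" by auto
          then have "a \<le> x" "x \<le> b" "?u \<le> b" "\<bar>x - ?u\<bar> < d"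
            using uv \<open>\<delta> < d\<close> by linarith+
          with uv(1) have "\<bar>f x - f ?u\<bar> < e'" by (intro d(2)) auto
          then show "norm (f x - f ?u) \<le> e'" by simp
        qed (use e' in auto)
        then show ?thesis using uv by (simp add: content_real)
      qed
      moreover have "\<bar>(\<Sum>i<k. \<delta> * f (a + real i * \<delta>)) - integral {a..?u} f\<bar> \<le> e' * (real k * \<delta>)"
        using Suc by simp
      moreover have "e' * (real (Suc k) * \<delta>) = e' * (real k * \<delta>) + e' * \<delta>"
        by (simp add: algebra_simps)
      ultimately show ?case by (simp only: sum.lessThan_Suc)
    qed simp
    from this[of "Suc N"] \<delta>(2)
    have "\<bar>(\<Sum>i<Suc N. \<delta> * f (a + real i * \<delta>)) - integral {a..b} f\<bar> \<le> e' * (b - a)"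
      by (simp del: of_nat_Suc sum.lessThan_Suc)
    then show "norm ((\<Sum>i<Suc N. (b - a) / real (Suc N) * f (a + real i * ((b - a) / real (Suc N))))
      - integral {a..b} f) < e"
      using e' unfolding \<delta>_def[symmetric] real_norm_def by linarith
  qed
qed

text \<open>Fatou's lemma for the Riemann sums: this avoids joint measurability in time and \<open>\<omega>\<close>.\<close>

lemma moment_le_integral:
  assumes ab: "a \<le> b" and cont: "AE \<omega> in M. continuous_on {a..b} (\<lambda>r. g r \<omega>)"
    and g: "\<And>r. r \<in> {a..b} \<Longrightarrow> moment_le M p K (g r)" and p: "even p" "0 < p"
  shows "moment_le M p ((b - a) * K) (\<lambda>\<omega>. integral {a..b} (\<lambda>r. g r \<omega>))"
proof -
  define S where "S N \<omega> = (\<Sum>i<Suc N. (b - a) / real (Suc N) * g (a + real i * ((b - a) / real (Suc N))) \<omega>)" for N \<omega>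
  have K: "0 \<le> K" using g[of a] ab moment_le_nonneg by auto
  have "moment_le M p ((b - a) * K) (S N)" for N
  proof -
    have "moment_le M p (\<Sum>i<Suc N. \<bar>(b - a) / real (Suc N)\<bar> * K) (S N)"
      unfolding S_def
    proof (intro moment_le_sum moment_le_cmult g p)
      fix i assume "i \<in> {..<Suc N}"
      then have "real i * ((b - a) / real (Suc N)) \<le> real (Suc N) * ((b - a) / real (Suc N))"
        using ab by (intro mult_right_mono) auto
      then show "a + real i * ((b - a) / real (Suc N)) \<in> {a..b}" using ab by auto
    qed simp
    then show ?thesis using ab by (simp del: of_nat_Suc sum.lessThan_Suc)
  qed
  then have "\<forall>N. \<exists>D. D \<in> borel_measurable M \<and> (AE \<omega> in M. ennreal (\<bar>S N \<omega>\<bar> ^ p) \<le> D \<omega>) \<and>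
        (\<integral>\<^sup>+\<omega>. D \<omega> \<partial>M) \<le> ennreal (((b - a) * K) ^ p)"
    unfolding moment_le_def by blast
  \<comment> \<open>The sums \<open>S N\<close> need not be measurable, so Fatou is applied to
    measurable majorants of their p-th powers.\<close>
  then obtain D where D: "\<And>N. D N \<in> borel_measurable M"
    "\<And>N. AE \<omega> in M. ennreal (\<bar>S N \<omega>\<bar> ^ p) \<le> D N \<omega>"
    "\<And>N. (\<integral>\<^sup>+\<omega>. D N \<omega> \<partial>M) \<le> ennreal (((b - a) * K) ^ p)"
    by metis
  note [measurable] = D(1)
  have "AE \<omega> in M. \<forall>N. ennreal (\<bar>S N \<omega>\<bar> ^ p) \<le> D N \<omega>"
    using D(2) by (simp add: AE_all_countable)
  with cont have "AE \<omega> in M. ennreal (\<bar>integral {a..b} (\<lambda>r. g r \<omega>)\<bar> ^ p) \<le> liminf (\<lambda>N. D N \<omega>)"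
  proof eventually_elim
    case (elim \<omega>)
    have "(\<lambda>N. S N \<omega>) \<longlonglongrightarrow> integral {a..b} (\<lambda>r. g r \<omega>)"
      unfolding S_def by (rule Riemann_sum_tendsto_integral[OF ab elim(1)])
    then have "(\<lambda>N. ennreal (\<bar>S N \<omega>\<bar> ^ p)) \<longlonglongrightarrow> ennreal (\<bar>integral {a..b} (\<lambda>r. g r \<omega>)\<bar> ^ p)"
      by (intro tendsto_ennrealI tendsto_intros)
    then have "ennreal (\<bar>integral {a..b} (\<lambda>r. g r \<omega>)\<bar> ^ p) = liminf (\<lambda>N. ennreal (\<bar>S N \<omega>\<bar> ^ p))"
      by (intro lim_imp_Liminf[symmetric]) auto
    also have "\<dots> \<le> liminf (\<lambda>N. D N \<omega>)"
      using elim(2) by (intro Liminf_mono) auto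
    finally show ?case .
  qed
  moreover have "(\<integral>\<^sup>+\<omega>. liminf (\<lambda>N. D N \<omega>) \<partial>M) \<le> ennreal (((b - a) * K) ^ p)"
  proof -
    have "(\<integral>\<^sup>+\<omega>. liminf (\<lambda>N. D N \<omega>) \<partial>M) \<le> liminf (\<lambda>N. \<integral>\<^sup>+\<omega>. D N \<omega> \<partial>M)"
      by (rule nn_integral_liminf) measurable
    also have "\<dots> \<le> liminf (\<lambda>N::nat. ennreal (((b - a) * K) ^ p))"
      by (intro Liminf_mono always_eventually allI D(3))
    finally show ?thesis by (simp add: Liminf_const)
  qed
  ultimately show ?thesis
    unfolding moment_le_def using ab K by (intro conjI bexI[of _ "\<lambda>\<omega>. liminf (\<lambda>N. D N \<omega>)"]) auto
qed

section \<open>Gaussian increments and weighted sums\<close>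

lemma gaussian_rv_integrable:
  assumes "prob_space M" "gaussian_rv M Z"
  shows "integrable M Z" "integrable M (\<lambda>\<omega>. (Z \<omega>)\<^sup>2)"
proof -
  interpret prob_space M by fact
  have [measurable]: "Z \<in> borel_measurable M"
    using assms by (simp add: gaussian_rv_def)
  from assms obtain \<mu> where "(\<exists>s>0. distributed M lborel Z (\<lambda>x. ennreal (normal_density \<mu> s x))) \<or> (AE \<omega> in M. Z \<omega> = \<mu>)"
    by (auto simp: gaussian_rv_def)
  then have int: "integrable M (\<lambda>\<omega>. (Z \<omega> - \<mu>) ^ k)" for k
  proof
    assume "\<exists>s>0. distributed M lborel Z (\<lambda>x. ennreal (normal_density \<mu> s x))"
    then obtain s where s: "0 < s" "distributed M lborel Z (\<lambda>x. ennreal (normal_density \<mu> s x))" by auto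
    show ?thesis
      using distributed_integrable[OF s(2), of "\<lambda>x. (x - \<mu>) ^ k"] integrable_normal_moment[OF s(1), of \<mu> k]
      by simp
  next
    assume "AE \<omega> in M. Z \<omega> = \<mu>"
    then have "integrable M (\<lambda>\<omega>. (Z \<omega> - \<mu>) ^ k) \<longleftrightarrow> integrable M (\<lambda>\<omega>. 0 ^ k :: real)"
      by (intro integrable_cong_AE) auto
    then show ?thesis by simp
  qed
  have "integrable M (\<lambda>\<omega>. (Z \<omega> - \<mu>) ^ 1 + \<mu>)"
    by (intro Bochner_Integration.integrable_add int) simp
  then show "integrable M Z" by simp
  have "integrable M (\<lambda>\<omega>. (Z \<omega> - \<mu>) ^ 2 + 2 * \<mu> * (Z \<omega> - \<mu>) ^ 1 + \<mu>\<^sup>2)"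
    by (intro Bochner_Integration.integrable_add integrable_mult_right int) simp
  also have "(\<lambda>\<omega>. (Z \<omega> - \<mu>) ^ 2 + 2 * \<mu> * (Z \<omega> - \<mu>) ^ 1 + \<mu>\<^sup>2) = (\<lambda>\<omega>. (Z \<omega>)\<^sup>2)"
    by (auto simp: power2_eq_square algebra_simps)
  finally show "integrable M (\<lambda>\<omega>. (Z \<omega>)\<^sup>2)" .
qed

text \<open>A centred normal variable with variance s^2 has fourth moment 3 s^4, and 3 \<le> 2^4
  explains the factor 2. In the degenerate case the zero mean forces the constant value to be
  0.\<close>

lemma gaussian_rv_moment_le_4:
  assumes "prob_space M" "gaussian_rv M Z" and mean: "(LINT \<omega>|M. Z \<omega>) = 0"
    and var: "(LINT \<omega>|M. (Z \<omega>)\<^sup>2) \<le> v\<^sup>2" and v: "0 \<le> v"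
  shows "moment_le M 4 (2 * v) Z"
proof -
  interpret prob_space M by fact
  have [measurable]: "Z \<in> borel_measurable M"
    using assms by (simp add: gaussian_rv_def)
  from assms obtain \<mu> where "(\<exists>s>0. distributed M lborel Z (\<lambda>x. ennreal (normal_density \<mu> s x))) \<or> (AE \<omega> in M. Z \<omega> = \<mu>)"
    by (auto simp: gaussian_rv_def)
  then have "(\<integral>\<^sup>+\<omega>. ennreal (\<bar>Z \<omega>\<bar> ^ 4) \<partial>M) \<le> ennreal ((2 * v) ^ 4)"
  proof
    assume "\<exists>s>0. distributed M lborel Z (\<lambda>x. ennreal (normal_density \<mu> s x))"
    then obtain s where s: "0 < s" "distributed M lborel Z (\<lambda>x. ennreal (normal_density \<mu> s x))" by auto
    have "\<mu> = 0"
      using distributed_integral[OF s(2), of "\<lambda>x. x"] mean integral_normal_moment_nz_1[OF s(1), of \<mu>] by simp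
    have "(LINT \<omega>|M. (Z \<omega>)\<^sup>2) = s\<^sup>2"
      using distributed_integral[OF s(2), of "\<lambda>x. x\<^sup>2"] \<open>\<mu> = 0\<close>
        integral_normal_moment_even[OF s(1), of 0 1] by simp
    then have "s \<le> v" using var v s(1) by (simp add: power2_le_iff_abs_le)
    have int: "integrable M (\<lambda>\<omega>. (Z \<omega>) ^ 4)"
      using distributed_integrable[OF s(2), of "\<lambda>x. x ^ 4"] \<open>\<mu> = 0\<close>
        integrable_normal_moment[OF s(1), of 0 4] by simp
    have "(LINT \<omega>|M. (Z \<omega>) ^ 4) = 3 * s ^ 4"
      using distributed_integral[OF s(2), of "\<lambda>x. x ^ 4"] \<open>\<mu> = 0\<close>
        integral_normal_moment_even[OF s(1), of 0 2] s(1)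
      by (simp add: fact_numeral power2_eq_square power4_eq_xxxx)
    also have "\<dots> \<le> 16 * v ^ 4"
      using power_mono[OF \<open>s \<le> v\<close>, of 4] s(1) by (intro mult_mono) auto
    finally show ?thesis
      using nn_integral_eq_integral[OF int] by (simp add: power_even_abs power_mult_distrib ennreal_leI)
  next
    assume *: "AE \<omega> in M. Z \<omega> = \<mu>"
    have "(LINT \<omega>|M. Z \<omega>) = (LINT \<omega>|M. \<mu>)"
      using * by (intro integral_cong_AE) auto
    then have "\<mu> = 0" using mean by (simp add: prob_space)
    with * have "(\<integral>\<^sup>+\<omega>. ennreal (\<bar>Z \<omega>\<bar> ^ 4) \<partial>M) = (\<integral>\<^sup>+\<omega>. 0 \<partial>M)"
      by (intro nn_integral_cong_AE) auto
    then show ?thesis by simp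
  qed
  then show ?thesis
    using v unfolding moment_le_def by (auto intro!: bexI[of _ "\<lambda>\<omega>. ennreal (\<bar>Z \<omega>\<bar> ^ 4)"])
qed

text \<open>The definition speaks of sets of distinct times, whereas the times \<open>u k\<close>
  may coincide: neighbouring increments can share an endpoint. Coefficients of equal times are
  collected.\<close>

lemma gaussian_process_sum:
  assumes "gaussian_process M I B" "finite K" "\<And>k. k \<in> K \<Longrightarrow> u k \<in> I"
  shows "gaussian_rv M (\<lambda>\<omega>. \<Sum>k\<in>K. c k * B (u k) \<omega>)"
proof -
  have "(\<Sum>k\<in>K. c k * B (u k) \<omega>) = (\<Sum>t\<in>u ` K. (\<Sum>k\<in>{k\<in>K. u k = t}. c k) * B t \<omega>)" for \<omega>
    unfolding sum_distrib_right by (subst sum.image_gen[OF assms(2), of _ u]) (auto intro!: sum.cong)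
  moreover have "gaussian_rv M (\<lambda>\<omega>. \<Sum>t\<in>u ` K. (\<Sum>k\<in>{k\<in>K. u k = t}. c k) * B t \<omega>)"
    using assms unfolding gaussian_process_def by (auto simp: image_subset_iff)
  ultimately show ?thesis by simp
qed

text \<open>Concavity of the power function: its graph lies below the tangent at the midpoint m = x
  + \<delta>. That tangent bound is Young's inequality for y/m and 1, and the two linear terms
  average to the value at m.\<close>

lemma powr_second_difference_nonpos:
  fixes x \<delta> \<alpha> :: real
  assumes "0 < \<alpha>" "\<alpha> \<le> 1" "0 \<le> x" "0 \<le> \<delta>"
  shows "(x + 2 * \<delta>) powr \<alpha> + x powr \<alpha> \<le> 2 * (x + \<delta>) powr \<alpha>"
proof (cases "x + \<delta> = 0")
  case False
  define m where "m = x + \<delta>"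
  have m: "0 < m" using False assms by (simp add: m_def)
  have le: "y powr \<alpha> \<le> m powr \<alpha> * (\<alpha> * (y / m) + (1 - \<alpha>))" if "0 \<le> y" for y
  proof (cases "y = 0")
    case False
    have "(y / m) powr \<alpha> * 1 powr (1 - \<alpha>) \<le> \<alpha> * (y / m) + (1 - \<alpha>) * 1"
      using assms m that False by (intro Youngs_inequality_0) auto
    then have "m powr \<alpha> * (y / m) powr \<alpha> \<le> m powr \<alpha> * (\<alpha> * (y / m) + (1 - \<alpha>))"
      by (intro mult_left_mono) auto
    then show ?thesis using m that by (simp flip: powr_mult)
  qed (use assms in simp)
  have "(x + 2 * \<delta>) powr \<alpha> + x powr \<alpha>
      \<le> m powr \<alpha> * (\<alpha> * ((x + 2 * \<delta>) / m) + (1 - \<alpha>)) + m powr \<alpha> * (\<alpha> * (x / m) + (1 - \<alpha>))"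
    using assms by (intro add_mono le) auto
  also have "\<dots> = m powr \<alpha> * (\<alpha> * (((x + 2 * \<delta>) + x) / m) + 2 * (1 - \<alpha>))"
    by (simp add: add_divide_distrib algebra_simps)
  also have "(x + 2 * \<delta>) + x = 2 * m" by (simp add: m_def)
  also have "m powr \<alpha> * (\<alpha> * (2 * m / m) + 2 * (1 - \<alpha>)) = 2 * m powr \<alpha>"
    using m by (simp add: algebra_simps)
  finally show ?thesis by (simp add: m_def)
next
  case True
  then have "x = 0" "\<delta> = 0" using assms by auto
  then show ?thesis by simp
qed

section \<open>Increments of fractional Brownian motion\<close>

text \<open>Linearity of the integral, needed to expand variances of increments, requires
  integrability, which the covariance formula alone does not supply since the Bochner integral of a
  non-integrable function is 0. It follows from Gaussianity of the marginals, which are linear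
  combinations with a single term, indexed by \<open>{()}\<close>.\<close>

lemma fbm_covariance:
  assumes "prob_space M" "fractional_brownian_motion M H T B" "s \<in> {0..T}" "t \<in> {0..T}"
  shows "integrable M (\<lambda>\<omega>. B s \<omega> * B t \<omega>)" "integrable M (B s)"
    "(LINT \<omega>|M. B s \<omega>) = 0"
    "(LINT \<omega>|M. B s \<omega> * B t \<omega>) = 1 / 2 * (t powr (2 * H) + s powr (2 * H) - \<bar>t - s\<bar> powr (2 * H))"
proof -
  have g: "gaussian_rv M (B r)" if "r \<in> {0..T}" for r
    using gaussian_process_sum[of M "{0..T}" B "{()}" "\<lambda>_. r" "\<lambda>_. 1"] assms(2) that
    by (simp add: fractional_brownian_motion_def)
  note int = gaussian_rv_integrable[OF assms(1) g]
  have [measurable]: "B s \<in> borel_measurable M" "B t \<in> borel_measurable M"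
    using g assms by (auto simp: gaussian_rv_def)
  show "integrable M (\<lambda>\<omega>. B s \<omega> * B t \<omega>)"
  proof (rule Bochner_Integration.integrable_bound[OF Bochner_Integration.integrable_add[OF int(2)[OF assms(3)] int(2)[OF assms(4)]]])
    have "\<bar>x * y\<bar> \<le> x\<^sup>2 + y\<^sup>2" for x y :: real
    proof -
      have "0 \<le> (\<bar>x\<bar> - \<bar>y\<bar>)\<^sup>2" by simp
      then have "2 * \<bar>x * y\<bar> \<le> x\<^sup>2 + y\<^sup>2" by (simp add: power2_diff abs_mult)
      then show ?thesis by (smt (verit) abs_ge_zero)
    qed
    then show "AE \<omega> in M. norm (B s \<omega> * B t \<omega>) \<le> norm ((B s \<omega>)\<^sup>2 + (B t \<omega>)\<^sup>2)"
      by auto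
  qed simp
qed (use assms gaussian_rv_integrable[OF assms(1)] gaussian_process_sum[of M "{0..T}" B "{()}" "\<lambda>_. s" "\<lambda>_. 1"]
     in \<open>auto simp: fractional_brownian_motion_def\<close>)

text \<open>Since \<open>2 H \<le> 1\<close>, increments over disjoint intervals are negatively correlated, so the variance
  of their sum is at most the sum of the variances.\<close>

lemma fbm_increments_moment_le:
  fixes u :: "nat \<Rightarrow> real"
  assumes M: "prob_space M" and B: "fractional_brownian_motion M H T B" and H: "0 < H" "H < 1 / 2"
    and K: "finite K" and \<delta>: "0 \<le> \<delta>" and u: "\<And>k. k \<in> K \<Longrightarrow> 0 \<le> u k \<and> u k + \<delta> \<le> T"
    and sep: "\<And>k l. k \<in> K \<Longrightarrow> l \<in> K \<Longrightarrow> k < l \<Longrightarrow> u k + \<delta> \<le> u l"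
  shows "moment_le M 4 (2 * (sqrt (card K) * \<delta> powr H)) (\<lambda>\<omega>. \<Sum>k\<in>K. B (u k + \<delta>) \<omega> - B (u k) \<omega>)"
proof -
  interpret prob_space M by fact
  let ?Z = "\<lambda>\<omega>. \<Sum>k\<in>K. B (u k + \<delta>) \<omega> - B (u k) \<omega>"
  have in_I: "u k \<in> {0..T}" "u k + \<delta> \<in> {0..T}" if "k \<in> K" for k
    using u[OF that] \<delta> by auto
  note cov = fbm_covariance[OF M B]
  define E where "E k l = (LINT \<omega>|M. (B (u k + \<delta>) \<omega> - B (u k) \<omega>) * (B (u l + \<delta>) \<omega> - B (u l) \<omega>))" for k l
  have int: "integrable M (\<lambda>\<omega>. (B (u k + \<delta>) \<omega> - B (u k) \<omega>) * (B (u l + \<delta>) \<omega> - B (u l) \<omega>))"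
    if "k \<in> K" "l \<in> K" for k l
    using that in_I by (auto simp: algebra_simps intro!: cov(1) Bochner_Integration.integrable_add Bochner_Integration.integrable_diff)
  have E_eq: "E k l = 1 / 2 * (\<bar>u l + \<delta> - u k\<bar> powr (2 * H) + \<bar>u l - (u k + \<delta>)\<bar> powr (2 * H)
      - 2 * \<bar>u l - u k\<bar> powr (2 * H))" if "k \<in> K" "l \<in> K" for k l
  proof -
    have "E k l = (LINT \<omega>|M. (B (u k + \<delta>) \<omega> * B (u l + \<delta>) \<omega> - B (u k + \<delta>) \<omega> * B (u l) \<omega>)
        - (B (u k) \<omega> * B (u l + \<delta>) \<omega> - B (u k) \<omega> * B (u l) \<omega>))"
      unfolding E_def by (intro Bochner_Integration.integral_cong) (auto simp: algebra_simps)
    also have "\<dots> = (LINT \<omega>|M. B (u k + \<delta>) \<omega> * B (u l + \<delta>) \<omega>) - (LINT \<omega>|M. B (u k + \<delta>) \<omega> * B (u l) \<omega>)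
        - ((LINT \<omega>|M. B (u k) \<omega> * B (u l + \<delta>) \<omega>) - (LINT \<omega>|M. B (u k) \<omega> * B (u l) \<omega>))"
      using in_I that by (simp add: cov(1))
    finally show ?thesis
      using in_I that by (simp add: cov(4) add_divide_distrib diff_divide_distrib)
  qed
  \<comment> \<open>With x the gap between the two intervals, twice the covariance is the second
    difference of \<open>y powr (2 * H)\<close> over x, x + \<delta>, x + 2\<delta>.\<close>
  have E_off: "E k l \<le> 0" if "k \<in> K" "l \<in> K" "k \<noteq> l" for k l
  proof -
    have *: "\<bar>q + \<delta> - p\<bar> powr (2 * H) + \<bar>q - (p + \<delta>)\<bar> powr (2 * H) \<le> 2 * \<bar>q - p\<bar> powr (2 * H)"
      if "p + \<delta> \<le> q" for p q
      using powr_second_difference_nonpos[of "2 * H" "q - p - \<delta>" \<delta>] H \<delta> that by (simp add: algebra_simps)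
    have eq: "\<bar>u l + \<delta> - u k\<bar> = \<bar>u k - (u l + \<delta>)\<bar>" "\<bar>u l - (u k + \<delta>)\<bar> = \<bar>u k + \<delta> - u l\<bar>" "\<bar>u l - u k\<bar> = \<bar>u k - u l\<bar>"
      by linarith+
    have "u k + \<delta> \<le> u l \<or> u l + \<delta> \<le> u k"
      using sep[of k l] sep[of l k] that by linarith
    then consider "u k + \<delta> \<le> u l" | "u l + \<delta> \<le> u k" by blast
    then show ?thesis
    proof cases
      case 1
      then show ?thesis using *[of "u k" "u l"] that by (simp add: E_eq)
    next
      case 2
      then show ?thesis using *[of "u l" "u k"] that by (simp add: E_eq eq)
    qed
  qed
  have E_diag: "E k k = \<delta> powr (2 * H)" if "k \<in> K" for k
    using that \<delta> by (simp add: E_eq)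
  have "(LINT \<omega>|M. (?Z \<omega>)\<^sup>2) = (\<Sum>k\<in>K. \<Sum>l\<in>K. E k l)"
    unfolding power2_eq_square sum_product E_def using int
    by (simp add: Bochner_Integration.integral_sum Bochner_Integration.integrable_sum)
  also have "\<dots> \<le> (\<Sum>k\<in>K. \<Sum>l\<in>K. if l = k then \<delta> powr (2 * H) else 0)"
    using E_diag E_off by (intro sum_mono) auto
  also have "\<dots> = real (card K) * \<delta> powr (2 * H)"
    using K by simp
  also have "\<dots> = (sqrt (card K) * \<delta> powr H)\<^sup>2"
    by (simp add: power_mult_distrib power2_eq_square[of "\<delta> powr H"] flip: powr_add)
  finally have var: "(LINT \<omega>|M. (?Z \<omega>)\<^sup>2) \<le> (sqrt (card K) * \<delta> powr H)\<^sup>2" .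
  have mean: "(LINT \<omega>|M. ?Z \<omega>) = 0"
  proof -
    have 1: "integrable M (B s)" "(LINT \<omega>|M. B s \<omega>) = 0" if "s \<in> {0..T}" for s
      using cov(2,3)[OF that that] .
    have "(LINT \<omega>|M. ?Z \<omega>) = (\<Sum>k\<in>K. LINT \<omega>|M. B (u k + \<delta>) \<omega> - B (u k) \<omega>)"
      using in_I by (intro Bochner_Integration.integral_sum Bochner_Integration.integrable_diff 1)
    also have "\<dots> = 0"
      using in_I by (intro sum.neutral) (simp add: 1 del: atLeastAtMost_iff)
    finally show ?thesis .
  qed
  \<comment> \<open>The Boolean index marks the right or left endpoint of an increment, which turns
    the sum of differences into one linear combination of values of \<open>B\<close>.\<close>
  have "gaussian_rv M (\<lambda>\<omega>. \<Sum>(k, b)\<in>K \<times> UNIV. (if b then 1 else - 1) * B (if b then u k + \<delta> else u k) \<omega>)"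
    using gaussian_process_sum[of M "{0..T}" B "K \<times> UNIV" "\<lambda>(k, b). if b then u k + \<delta> else u k" "\<lambda>(k, b). if b then 1 else - 1"]
      B K in_I by (auto simp: fractional_brownian_motion_def case_prod_beta)
  moreover have "(\<Sum>(k, b)\<in>K \<times> UNIV. (if b then 1 else - 1) * B (if b then u k + \<delta> else u k) \<omega>) = ?Z \<omega>" for \<omega>
    by (simp add: UNIV_bool flip: sum.cartesian_product)
  ultimately have "gaussian_rv M ?Z" by simp
  from gaussian_rv_moment_le_4[OF M this mean var] show ?thesis by simp
qed

text \<open>Splitting the block in half costs one product of an increment of \<open>w\<close> with a partial sum of \<open>d\<close>.
  As \<open>H + 1 / 2 < 1\<close>, these costs, weighted by the number of blocks, decrease geometrically in the block
  length, so single steps dominate.\<close>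

lemma dyadic_block_sum_moment_le:
  fixes w d :: "nat \<Rightarrow> 'w \<Rightarrow> real"
  assumes H: "H < 1 / 2" and PQ: "0 \<le> P" "0 \<le> Q"
    and w: "\<And>i j. i \<le> j \<Longrightarrow> j < n \<Longrightarrow> moment_le M 4 (P * real (j - i) powr H) (\<lambda>\<omega>. w j \<omega> - w i \<omega>)"
    and d: "\<And>i j. i \<le> j \<Longrightarrow> j \<le> n \<Longrightarrow> moment_le M 4 (Q * sqrt (real (j - i))) (\<lambda>\<omega>. \<Sum>k=i..<j. d k \<omega>)"
  defines "\<rho> \<equiv> 2 powr (H - 1 / 2)"
  defines "\<kappa> \<equiv> P * Q / (2 * (1 - \<rho>))"
  shows "i \<le> m \<Longrightarrow> m \<le> n \<Longrightarrow> m - i \<le> 2 ^ J \<Longrightarrow>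
    moment_le M 2 (\<kappa> * (2 ^ J * (1 - \<rho> ^ J))) (\<lambda>\<omega>. \<Sum>k=i..<m. (w k \<omega> - w i \<omega>) * d k \<omega>)"
proof (induction J arbitrary: i m)
  case 0
  \<comment> \<open>A block of at most one step costs nothing, as its only centred weight is
    \<open>w i - w i\<close>. Accordingly the factor \<open>1 - \<rho> ^ J\<close> vanishes at J =
    0.\<close>
  then have "m = i \<or> m = Suc i" by auto
  then have "(\<Sum>k=i..<m. (w k \<omega> - w i \<omega>) * d k \<omega>) = 0" for \<omega> by auto
  then show ?case by (simp add: moment_le_zero)
next
  case (Suc J)
  have \<rho>: "0 < \<rho>" "\<rho> < 1"
    using H powr_less_mono[of "H - 1 / 2" 0 "2::real"] by (auto simp: \<rho>_def)
  then have \<kappa>: "0 \<le> \<kappa>" using PQ by (simp add: \<kappa>_def)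
  have mono: "2 ^ J * (1 - \<rho> ^ J) \<le> 2 ^ Suc J * (1 - \<rho> ^ Suc J)"
    using \<rho> by (intro mult_mono) (auto simp: power_le_one mult_left_le_one_le)
  show ?case
  proof (cases "m - i \<le> 2 ^ J")
    case True
    with Suc mono \<kappa> show ?thesis
      by (intro moment_le_mono[OF Suc.IH[of i m]] mult_left_mono) auto
  next
    case False
    define j where "j = i + 2 ^ J"
    have j: "i \<le> j" "j < m" "j - i = 2 ^ J" "m - j \<le> 2 ^ J"
      using False Suc.prems by (auto simp: j_def)
    have "P * real (j - i) powr H * (Q * sqrt (real (m - j))) \<le> P * (2 ^ J) powr H * (Q * sqrt (2 ^ J))"
      proof -
      have "real (m - j) \<le> 2 ^ J"
        using of_nat_mono[OF j(4), where ?'a=real] by simp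
      then show ?thesis using PQ j by (intro mult_mono) (auto simp: j(3))
    qed
    also have "(2 ^ J) powr H * sqrt (2 ^ J) = 2 ^ J * \<rho> ^ J"
    proof -
      have "(2 ^ J) powr H * sqrt (2 ^ J) = (2 ^ J) powr (1 + (H - 1 / 2))"
        by (simp add: powr_half_sqrt[symmetric] add.commute flip: powr_add)
      also have "\<dots> = 2 ^ J * \<rho> ^ J"
        unfolding powr_add \<rho>_def by (simp add: powr_powr mult.commute flip: powr_realpow)
      finally show ?thesis .
    qed
    then have "P * (2 ^ J) powr H * (Q * sqrt (2 ^ J)) = P * Q * (2 ^ J * \<rho> ^ J)"
      by (simp add: ac_simps)
    \<comment> \<open>Here the value of \<open>\<kappa>\<close> is determined: the cost of a split
      becomes the telescoping difference between \<open>1 - \<rho> ^ J\<close> and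
      \<open>1 - \<rho> ^ Suc J\<close>.\<close>
    also have "\<dots> = \<kappa> * (2 ^ Suc J * (\<rho> ^ J - \<rho> ^ Suc J))"
      using \<rho> by (simp add: \<kappa>_def field_simps)
    finally have cost: "P * real (j - i) powr H * (Q * sqrt (real (m - j))) \<le> \<kappa> * (2 ^ Suc J * (\<rho> ^ J - \<rho> ^ Suc J))" .
    \<comment> \<open>Weights in the right part are recentred from \<open>w i\<close> to
      \<open>w j\<close>, so that the induction hypothesis applies there; the correction is the
      single product.\<close>
    have "(\<Sum>k=i..<m. (w k \<omega> - w i \<omega>) * d k \<omega>) = (\<Sum>k=i..<j. (w k \<omega> - w i \<omega>) * d k \<omega>)
        + (\<Sum>k=j..<m. (w k \<omega> - w j \<omega>) * d k \<omega>) + (w j \<omega> - w i \<omega>) * (\<Sum>k=j..<m. d k \<omega>)" for \<omega>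
    proof -
      have "(\<Sum>k=j..<m. (w k \<omega> - w i \<omega>) * d k \<omega>)
          = (\<Sum>k=j..<m. (w k \<omega> - w j \<omega>) * d k \<omega>) + (w j \<omega> - w i \<omega>) * (\<Sum>k=j..<m. d k \<omega>)"
        unfolding sum_distrib_left sum.distrib[symmetric] by (intro sum.cong) (auto simp: algebra_simps)
      then show ?thesis
        using j by (simp flip: sum.atLeastLessThan_concat[of i j m])
    qed
    moreover have "moment_le M 2 (\<kappa> * (2 ^ J * (1 - \<rho> ^ J)) + \<kappa> * (2 ^ J * (1 - \<rho> ^ J))
        + P * real (j - i) powr H * (Q * sqrt (real (m - j))))
        (\<lambda>\<omega>. (\<Sum>k=i..<j. (w k \<omega> - w i \<omega>) * d k \<omega>)
        + (\<Sum>k=j..<m. (w k \<omega> - w j \<omega>) * d k \<omega>) + (w j \<omega> - w i \<omega>) * (\<Sum>k=j..<m. d k \<omega>))"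
      using j Suc.prems
      by (intro moment_le_add[OF moment_le_add[OF Suc.IH Suc.IH] moment_le_mult[OF w d]]) auto
    moreover have "\<kappa> * (2 ^ J * (1 - \<rho> ^ J)) + \<kappa> * (2 ^ J * (1 - \<rho> ^ J))
        + \<kappa> * (2 ^ Suc J * (\<rho> ^ J - \<rho> ^ Suc J)) = \<kappa> * (2 ^ Suc J * (1 - \<rho> ^ Suc J))"
      by (simp add: algebra_simps)
    ultimately show ?thesis
      using cost by (auto intro: moment_le_mono)
  qed
qed

text \<open>The block estimate handles weights centred at \<open>w 0\<close>. What remains is
  \<open>w 0\<close> times the full sum of the \<open>d k\<close>, which is only of order sqrt
  m.\<close>

lemma weighted_sum_moment_le:
  fixes w d :: "nat \<Rightarrow> 'w \<Rightarrow> real"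
  assumes H: "H < 1 / 2" and PQ: "0 \<le> P" "0 \<le> Q"
    and w: "\<And>i j. i \<le> j \<Longrightarrow> j < n \<Longrightarrow> moment_le M 4 (P * real (j - i) powr H) (\<lambda>\<omega>. w j \<omega> - w i \<omega>)"
    and w0: "moment_le M 4 W (w 0)"
    and d: "\<And>i j. i \<le> j \<Longrightarrow> j \<le> n \<Longrightarrow> moment_le M 4 (Q * sqrt (real (j - i))) (\<lambda>\<omega>. \<Sum>k=i..<j. d k \<omega>)"
    and m: "1 \<le> m" "m \<le> n"
  shows "moment_le M 2 (P * Q / (1 - 2 powr (H - 1 / 2)) * real m + W * (Q * sqrt (real m)))
    (\<lambda>\<omega>. \<Sum>k<m. w k \<omega> * d k \<omega>)"
proof -
  \<comment> \<open>The least power of two above m is at most 2 m; this factor 2 cancels the one in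
    the denominator of \<open>\<kappa>\<close>.\<close>
  obtain j where j: "2 ^ j \<le> m" "m < 2 ^ (j + 1)"
    using ex_power_ivl1[of 2 m] m by auto
  define \<rho> where "\<rho> = (2::real) powr (H - 1 / 2)"
  have \<rho>: "0 < \<rho>" "\<rho> < 1"
    using H powr_less_mono[of "H - 1 / 2" 0 "2::real"] by (auto simp: \<rho>_def)
  have "moment_le M 2 (P * Q / (2 * (1 - \<rho>)) * (2 ^ (j + 1) * (1 - \<rho> ^ (j + 1))) + W * (Q * sqrt (real (m - 0))))
      (\<lambda>\<omega>. (\<Sum>k=0..<m. (w k \<omega> - w 0 \<omega>) * d k \<omega>) + w 0 \<omega> * (\<Sum>k=0..<m. d k \<omega>))"
    unfolding \<rho>_def
    by (intro moment_le_add[OF dyadic_block_sum_moment_le[OF H PQ w d] moment_le_mult[OF w0 d]])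
       (use j m in auto)
  moreover have "(\<Sum>k=0..<m. (w k \<omega> - w 0 \<omega>) * d k \<omega>) + w 0 \<omega> * (\<Sum>k=0..<m. d k \<omega>) = (\<Sum>k<m. w k \<omega> * d k \<omega>)" for \<omega>
    unfolding sum_distrib_left sum.distrib[symmetric] atLeast0LessThan by (intro sum.cong) (auto simp: algebra_simps)
  moreover have "P * Q / (2 * (1 - \<rho>)) * (2 ^ (j + 1) * (1 - \<rho> ^ (j + 1))) \<le> P * Q / (1 - \<rho>) * real m"
  proof -
    have "(2::real) ^ (j + 1) * (1 - \<rho> ^ (j + 1)) \<le> (2 * real m) * 1"
    proof (intro mult_mono)
      show "(2::real) ^ (j + 1) \<le> 2 * real m"
        using of_nat_mono[OF j(1), where ?'a=real] by simp
    qed (use \<rho> power_le_one[of \<rho> "j + 1"] in auto)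
    then have "P * Q / (2 * (1 - \<rho>)) * (2 ^ (j + 1) * (1 - \<rho> ^ (j + 1))) \<le> P * Q / (2 * (1 - \<rho>)) * (2 * real m)"
      using PQ \<rho> by (intro mult_left_mono) auto
    also have "\<dots> = P * Q / (1 - \<rho>) * real m"
      using \<rho> by (simp add: divide_simps)
    finally show ?thesis .
  qed
  ultimately show ?thesis
    unfolding \<rho>_def[symmetric] by (auto intro: moment_le_mono)
qed

section \<open>The solution\<close>

text \<open>The bound involves the integral of f and not its supremum: f will contain \<bar>B\<bar>,
  and moments pass through a time integral, while a supremum would call for a maximal
  inequality.\<close>

lemma gronwall_integral:
  fixes x f :: "real \<Rightarrow> real"
  assumes T: "0 \<le> T" and L: "0 \<le> L" and x: "continuous_on {0..T} x" and f: "continuous_on {0..T} f"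
    and f0: "\<And>t. t \<in> {0..T} \<Longrightarrow> 0 \<le> f t"
    and le: "\<And>t. t \<in> {0..T} \<Longrightarrow> \<bar>x t\<bar> \<le> f t + L * integral {0..t} (\<lambda>s. \<bar>x s\<bar>)"
    and t: "t \<in> {0..T}"
  shows "\<bar>x t\<bar> \<le> f t + L * exp (L * T) * integral {0..T} f"
proof -
  \<comment> \<open>With the integrating factor, the hypothesis bounds the derivative of the first
    term by exp(-L s) f(s) \<le> f(s); subtracting the integral of f makes \<open>J\<close>
    nonincreasing.\<close>
  define J where "J s = exp (- L * s) * integral {0..s} (\<lambda>u. \<bar>x u\<bar>) - integral {0..s} f" for s
  have x': "continuous_on {0..T} (\<lambda>u. \<bar>x u\<bar>)" using x by (intro continuous_intros)
  have J: "(J has_real_derivative exp (- L * s) * (\<bar>x s\<bar> - L * integral {0..s} (\<lambda>u. \<bar>x u\<bar>)) - f s)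
      (at s within {0..T})" if "s \<in> {0..T}" for s
    unfolding J_def
    by (rule derivative_eq_intros integral_has_real_derivative[OF x' that] integral_has_real_derivative[OF f that] refl | simp add: algebra_simps)+
  have "J t \<le> J 0"
  proof (rule DERIV_nonpos_imp_decreasing_open[of 0 t J])
    fix s assume s: "0 < s" "s < t"
    then have sT: "s \<in> {0..T}" using t by auto
    have "(J has_real_derivative exp (- L * s) * (\<bar>x s\<bar> - L * integral {0..s} (\<lambda>u. \<bar>x u\<bar>)) - f s) (at s)"
      using J[OF sT] s t by (simp add: at_within_Icc_at)
    moreover have "exp (- L * s) * (\<bar>x s\<bar> - L * integral {0..s} (\<lambda>u. \<bar>x u\<bar>)) \<le> 1 * f s"
    proof -
      have "exp (- L * s) * (\<bar>x s\<bar> - L * integral {0..s} (\<lambda>u. \<bar>x u\<bar>)) \<le> exp (- L * s) * f s"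
        using le[OF sT] by (intro mult_left_mono) auto
      also have "\<dots> \<le> 1 * f s"
        using f0[OF sT] L s by (intro mult_right_mono) auto
      finally show ?thesis .
    qed
    ultimately show "\<exists>y. (J has_real_derivative y) (at s) \<and> y \<le> 0" by force
  next
    have "continuous_on {0..T} J"
      by (rule DERIV_continuous_on[OF J])
    then show "continuous_on {0..t} J"
      by (rule continuous_on_subset) (use t in auto)
  qed (use t in auto)
  then have le_f: "exp (- L * t) * integral {0..t} (\<lambda>u. \<bar>x u\<bar>) \<le> integral {0..t} f"
    by (simp add: J_def)
  have int: "f integrable_on {0..T}" "f integrable_on {0..t}"
    using t by (auto intro!: integrable_continuous_real f continuous_on_subset[OF f])
  have "integral {0..t} (\<lambda>u. \<bar>x u\<bar>) = exp (L * t) * (exp (- L * t) * integral {0..t} (\<lambda>u. \<bar>x u\<bar>))"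
    by (simp add: exp_minus)
  also have "\<dots> \<le> exp (L * t) * integral {0..t} f"
    using le_f by (intro mult_left_mono) auto
  also have "\<dots> \<le> exp (L * T) * integral {0..T} f"
    using t L f0 int
    by (intro mult_mono integral_subset_le integral_nonneg) (auto intro: mult_left_mono)
  finally have "L * integral {0..t} (\<lambda>u. \<bar>x u\<bar>) \<le> L * (exp (L * T) * integral {0..T} f)"
    using L by (intro mult_left_mono)
  then show ?thesis using le[OF t] by (simp add: mult.assoc)
qed

section \<open>Coefficient bounds and explicit constants\<close>

text \<open>All estimates come from the mean value inequality. For the Taylor bound it is applied to
  z \<mapsto> a(z) - a'(y) z on the segment from x to y, where the derivative is at most L2 \<bar>x
  - y\<bar>.\<close>

lemma bounded_derivs_imp_bounds:
  assumes "bounded_derivs m a" "2 \<le> m"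
  obtains L1 L2 where "0 \<le> L1" "0 \<le> L2"
    "\<And>x y. \<bar>a x - a y\<bar> \<le> L1 * \<bar>x - y\<bar>"
    "\<And>x. \<bar>deriv a x\<bar> \<le> L1"
    "\<And>x y. \<bar>deriv a x - deriv a y\<bar> \<le> L2 * \<bar>x - y\<bar>"
    "\<And>x y. \<bar>a x - a y - deriv a y * (x - y)\<bar> \<le> L2 * (x - y)\<^sup>2"
proof -
  have *: "(\<forall>x. (deriv ^^ k) a field_differentiable at x) \<and> bounded (range ((deriv ^^ Suc k) a))"
    if "k < m" for k
    using assms(1) that unfolding bounded_derivs_def by blast
  have d1: "(a has_real_derivative deriv a x) (at x)"
    and d2: "(deriv a has_real_derivative deriv (deriv a) x) (at x)" for x
    using *[of 0] *[of 1] assms(2) by (auto simp: field_differentiable_derivI)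
  have "bounded (range (deriv a))" "bounded (range (deriv (deriv a)))"
    using *[of 0] *[of 1] assms(2) by auto
  then obtain L1 L2 where L: "0 < L1" "0 < L2" "\<And>x. \<bar>deriv a x\<bar> \<le> L1" "\<And>x. \<bar>deriv (deriv a) x\<bar> \<le> L2"
    by (auto simp: bounded_pos)
  have l1: "\<bar>a x - a y\<bar> \<le> L1 * \<bar>x - y\<bar>" for x y
    using field_differentiable_bound[of UNIV a "deriv a" L1 x y] d1 L by auto
  have l2: "\<bar>deriv a x - deriv a y\<bar> \<le> L2 * \<bar>x - y\<bar>" for x y
    using field_differentiable_bound[of UNIV "deriv a" "deriv (deriv a)" L2 x y] d2 L by auto
  have "\<bar>a x - a y - deriv a y * (x - y)\<bar> \<le> L2 * (x - y)\<^sup>2" for x y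
  proof -
    let ?S = "closed_segment x y"
    have "norm ((a x - deriv a y * x) - (a y - deriv a y * y)) \<le> (L2 * \<bar>x - y\<bar>) * norm (x - y)"
    proof (rule field_differentiable_bound[where S = ?S and f' = "\<lambda>z. deriv a z - deriv a y"])
      fix z assume "z \<in> ?S"
      then have "\<bar>z - y\<bar> \<le> \<bar>x - y\<bar>"
        by (auto simp: closed_segment_eq_real_ivl split: if_splits)
      then have "L2 * \<bar>z - y\<bar> \<le> L2 * \<bar>x - y\<bar>" using L by (intro mult_left_mono) auto
      then show "norm (deriv a z - deriv a y) \<le> L2 * \<bar>x - y\<bar>"
        using l2[of z y] by simp
      show "((\<lambda>z. a z - deriv a y * z) has_real_derivative deriv a z - deriv a y) (at z within ?S)"
        by (auto intro!: derivative_eq_intros has_field_derivative_at_within[OF d1])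
    qed auto
    then show ?thesis by (simp add: power2_eq_square algebra_simps abs_mult)
  qed
  then show ?thesis using that[of L1 L2] L l1 l2 by auto
qed

text \<open>No probability space occurs here, so the constants defined below can serve as one
  witness for all spaces, processes and step numbers.\<close>

locale sde_coefficients =
  fixes a a' :: "real \<Rightarrow> real" and H T \<sigma> x0 L1 L2 :: real
  assumes H: "0 < H" "H < 1 / 2" and T: "0 < T" and L: "0 \<le> L1" "0 \<le> L2"
    and a_lipschitz: "\<And>x y. \<bar>a x - a y\<bar> \<le> L1 * \<bar>x - y\<bar>"
    and a'_bound: "\<And>x. \<bar>a' x\<bar> \<le> L1"
    and a'_lipschitz: "\<And>x y. \<bar>a' x - a' y\<bar> \<le> L2 * \<bar>x - y\<bar>"
    and a_taylor: "\<And>x y. \<bar>a x - a y - a' y * (x - y)\<bar> \<le> L2 * (x - y)\<^sup>2"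
begin

definition forcing_const :: real where
  "forcing_const = \<bar>x0\<bar> + \<bar>a 0\<bar> * T + \<bar>\<sigma>\<bar> * (2 * T powr H)"

definition solution_const :: real where
  "solution_const = forcing_const + L1 * exp (L1 * T) * (T * forcing_const)"

definition drift_const :: real where
  "drift_const = \<bar>a 0\<bar> + L1 * solution_const"

definition increment_const :: real where
  "increment_const = drift_const * T powr (1 - H) + \<bar>\<sigma>\<bar> * 2"

text \<open>The bracket bounds the noise sum: first the centred weights, then the contribution of
  the initial weight. The next summand is the drift part of the increments of X, the last one the
  Taylor remainder.\<close>

definition remainder_const :: real where
  "remainder_const = \<bar>\<sigma>\<bar> * (2 * L2 * increment_const * T / (1 - 2 powr (H - 1 / 2)) + 2 * L1 * T powr (1 - H))
     + L1 * drift_const * T * T powr (1 - 2 * H) + L2 * increment_const\<^sup>2 * T"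

text \<open>The grid error, amplified by discrete Gronwall and by one more partial step, plus the
  local error of that partial step.\<close>

definition error_const :: real where
  "error_const = (1 + L1 * T) * remainder_const * exp (L1 * T) + L1 * increment_const * T powr (1 - H)"

lemma const_nonneg:
  "0 \<le> forcing_const" "0 \<le> solution_const" "0 \<le> drift_const" "0 \<le> increment_const"
  "0 \<le> remainder_const" "0 \<le> error_const"
proof -
  show 1: "0 \<le> forcing_const" using T by (simp add: forcing_const_def)
  show 2: "0 \<le> solution_const" using 1 T L by (simp add: solution_const_def)
  show 3: "0 \<le> drift_const" using 2 L by (simp add: drift_const_def)
  show 4: "0 \<le> increment_const" using 3 by (simp add: increment_const_def)
  have "2 powr (H - 1 / 2) \<le> (1::real)"
    using H powr_mono[of "H - 1 / 2" 0 "2::real"] by simp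
  then show 5: "0 \<le> remainder_const" using 3 4 L T by (simp add: remainder_const_def)
  show "0 \<le> error_const" using 4 5 L T by (simp add: error_const_def)
qed

lemma a_continuous: "continuous_on S a"
proof (rule continuous_on_subset[OF _ subset_UNIV])
  have "L1-lipschitz_on UNIV a"
    using a_lipschitz L by (auto simp: lipschitz_on_def dist_real_def)
  then show "continuous_on UNIV a" by (rule lipschitz_on_continuous_on)
qed

lemma a_linear_growth: "\<bar>a x\<bar> \<le> \<bar>a 0\<bar> + L1 * \<bar>x\<bar>"
  using a_lipschitz[of x 0] by simp

end

section \<open>Moments and increments of the solution\<close>

locale fbm_sde = sde_coefficients +
  fixes M :: "'w measure" and B X :: "real \<Rightarrow> 'w \<Rightarrow> real"
  assumes prob: "prob_space M" and fbm: "fractional_brownian_motion M H T B"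
    and sol: "sde_solution M a \<sigma> x0 T B X"
begin

lemma B_measurable: "t \<in> {0..T} \<Longrightarrow> B t \<in> borel_measurable M"
  using gaussian_process_sum[of M "{0..T}" B "{()}" "\<lambda>_. t" "\<lambda>_. 1"] fbm
  by (auto simp: fractional_brownian_motion_def gaussian_rv_def)

lemma X_measurable: "t \<in> {0..T} \<Longrightarrow> X t \<in> borel_measurable M"
  using sol by (simp add: sde_solution_def)

lemma paths_AE:
  "AE \<omega> in M. continuous_on {0..T} (\<lambda>t. B t \<omega>) \<and> B 0 \<omega> = 0 \<and> continuous_on {0..T} (\<lambda>t. X t \<omega>) \<and>
     (\<forall>t\<in>{0..T}. X t \<omega> = x0 + integral {0..t} (\<lambda>s. a (X s \<omega>)) + \<sigma> * B t \<omega>)"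
  using fbm sol unfolding fractional_brownian_motion_def sde_solution_def by auto

lemma a_path_continuous:
  "continuous_on {0..T} (\<lambda>t. X t \<omega>) \<Longrightarrow> 0 \<le> s \<Longrightarrow> t \<le> T \<Longrightarrow> continuous_on {s..t} (\<lambda>s. a (X s \<omega>))"
  by (rule continuous_on_compose2[OF a_continuous[of UNIV]])
     (auto intro: continuous_on_subset)

lemma B_increment_moment_le:
  assumes "0 \<le> s" "s \<le> t" "t \<le> T"
  shows "moment_le M 4 (2 * (t - s) powr H) (\<lambda>\<omega>. B t \<omega> - B s \<omega>)"
  using fbm_increments_moment_le[OF prob fbm H, of "{0}" "t - s" "\<lambda>_. s"] assms by simp

lemma B_moment_le:
  assumes "t \<in> {0..T}"
  shows "moment_le M 4 (2 * T powr H) (B t)"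
proof (rule moment_le_mono_AE)
  show "moment_le M 4 (2 * (t - 0) powr H) (\<lambda>\<omega>. B t \<omega> - B 0 \<omega>)"
    using assms by (intro B_increment_moment_le) auto
  show "AE \<omega> in M. \<bar>B t \<omega>\<bar> \<le> \<bar>B t \<omega> - B 0 \<omega>\<bar>"
    using paths_AE by eventually_elim auto
  show "2 * (t - 0) powr H \<le> 2 * T powr H"
    using assms H by (auto intro: powr_mono2)
qed

lemma X_moment_le:
  assumes t: "t \<in> {0..T}"
  shows "moment_le M 4 solution_const (X t)"
proof -
  \<comment> \<open>Linear growth of \<open>a\<close> leaves the constant part \<bar>a 0\<bar> T in
    the forcing term, and the part proportional to \<bar>X\<bar> is left to Gronwall, path by
    path.\<close>
  define f where "f s \<omega> = \<bar>x0\<bar> + \<bar>a 0\<bar> * T + \<bar>\<sigma>\<bar> * \<bar>B s \<omega>\<bar>" for s \<omega>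
  have f: "moment_le M 4 forcing_const (f s)" if "s \<in> {0..T}" for s
  proof -
    have "moment_le M 4 (\<bar>\<bar>x0\<bar> + \<bar>a 0\<bar> * T\<bar> + \<bar>\<bar>\<sigma>\<bar>\<bar> * (2 * T powr H)) (f s)"
      unfolding f_def
      by (intro moment_le_add moment_le_const moment_le_cmult moment_le_abs B_moment_le prob that) auto
    then show ?thesis using T by (simp add: forcing_const_def)
  qed
  have cont_f: "continuous_on {0..T} (\<lambda>s. f s \<omega>)" if "continuous_on {0..T} (\<lambda>s. B s \<omega>)" for \<omega>
    unfolding f_def by (intro continuous_intros that)
  have "moment_le M 4 ((T - 0) * forcing_const) (\<lambda>\<omega>. integral {0..T} (\<lambda>s. f s \<omega>))"
  proof (intro moment_le_integral f)
    show "AE \<omega> in M. continuous_on {0..T} (\<lambda>r. f r \<omega>)"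
      using paths_AE by eventually_elim (auto intro: cont_f)
  qed (use T in auto)
  from moment_le_add[OF f[OF t] moment_le_cmult[OF this, of "L1 * exp (L1 * T)"]]
  have "moment_le M 4 solution_const (\<lambda>\<omega>. f t \<omega> + L1 * exp (L1 * T) * integral {0..T} (\<lambda>s. f s \<omega>))"
    using L by (simp add: solution_const_def)
  then show ?thesis
  proof (rule moment_le_mono_AE)
    show "AE \<omega> in M. \<bar>X t \<omega>\<bar> \<le> \<bar>f t \<omega> + L1 * exp (L1 * T) * integral {0..T} (\<lambda>s. f s \<omega>)\<bar>"
      using paths_AE
    proof eventually_elim
      case (elim \<omega>)
      have "\<bar>X t \<omega>\<bar> \<le> f t \<omega> + L1 * exp (L1 * T) * integral {0..T} (\<lambda>s. f s \<omega>)"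
      proof (rule gronwall_integral[OF _ _ _ _ _ _ t])
        fix s assume s: "s \<in> {0..T}"
        have cont: "continuous_on {0..s} (\<lambda>u. a (X u \<omega>))" "continuous_on {0..s} (\<lambda>u. \<bar>a 0\<bar> + L1 * \<bar>X u \<omega>\<bar>)"
          "continuous_on {0..s} (\<lambda>u. L1 * \<bar>X u \<omega>\<bar>)"
          using s elim by (auto intro!: a_path_continuous continuous_intros intro: continuous_on_subset)
        have "\<bar>integral {0..s} (\<lambda>u. a (X u \<omega>))\<bar> \<le> integral {0..s} (\<lambda>u. \<bar>a 0\<bar> + L1 * \<bar>X u \<omega>\<bar>)"
          using integral_norm_bound_integral[OF integrable_continuous_real[OF cont(1)] integrable_continuous_real[OF cont(2)]]
            a_linear_growth by simp
        also have "\<dots> = s * \<bar>a 0\<bar> + L1 * integral {0..s} (\<lambda>u. \<bar>X u \<omega>\<bar>)"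
          using s integrable_continuous_real[OF cont(3)] by (subst Henstock_Kurzweil_Integration.integral_add) auto
        also have "s * \<bar>a 0\<bar> \<le> T * \<bar>a 0\<bar>"
          using s by (intro mult_right_mono) auto
        finally show "\<bar>X s \<omega>\<bar> \<le> f s \<omega> + L1 * integral {0..s} (\<lambda>u. \<bar>X u \<omega>\<bar>)"
          using elim s unfolding f_def abs_mult[symmetric] by (simp add: mult.commute)
      next
        fix s show "0 \<le> f s \<omega>" using T by (simp add: f_def)
      qed (use T L elim cont_f in auto)
      then show ?case by linarith
    qed
  qed simp
qed

lemma drift_moment_le:
  assumes "t \<in> {0..T}"
  shows "moment_le M 4 drift_const (\<lambda>\<omega>. a (X t \<omega>))"
proof (rule moment_le_mono_AE)
  show "moment_le M 4 (\<bar>\<bar>a 0\<bar>\<bar> + \<bar>L1\<bar> * solution_const) (\<lambda>\<omega>. \<bar>a 0\<bar> + L1 * \<bar>X t \<omega>\<bar>)"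
    by (intro moment_le_add moment_le_const moment_le_cmult moment_le_abs X_moment_le prob assms) auto
  show "AE \<omega> in M. \<bar>a (X t \<omega>)\<bar> \<le> \<bar>\<bar>a 0\<bar> + L1 * \<bar>X t \<omega>\<bar>\<bar>"
  proof (intro AE_I2)
    fix \<omega>
    show "\<bar>a (X t \<omega>)\<bar> \<le> \<bar>\<bar>a 0\<bar> + L1 * \<bar>X t \<omega>\<bar>\<bar>"
      using a_linear_growth[of "X t \<omega>"] by linarith
  qed
qed (use L in \<open>auto simp: drift_const_def\<close>)

lemma drift_integral_moment_le:
  assumes "0 \<le> s" "s \<le> t" "t \<le> T"
  shows "moment_le M 4 ((t - s) * drift_const) (\<lambda>\<omega>. integral {s..t} (\<lambda>u. a (X u \<omega>)))"
proof (intro moment_le_integral drift_moment_le)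
  show "AE \<omega> in M. continuous_on {s..t} (\<lambda>r. a (X r \<omega>))"
    using paths_AE by eventually_elim (use assms a_path_continuous in auto)
qed (use assms in auto)

lemma X_increment_AE:
  "AE \<omega> in M. \<forall>s t. 0 \<le> s \<longrightarrow> s \<le> t \<longrightarrow> t \<le> T \<longrightarrow>
     X t \<omega> - X s \<omega> = integral {s..t} (\<lambda>u. a (X u \<omega>)) + \<sigma> * (B t \<omega> - B s \<omega>)"
  using paths_AE
proof eventually_elim
  case (elim \<omega>)
  show ?case
  proof (intro allI impI)
    fix s t assume st: "0 \<le> s" "s \<le> t" "t \<le> T"
    have "integral {0..s} (\<lambda>u. a (X u \<omega>)) + integral {s..t} (\<lambda>u. a (X u \<omega>)) = integral {0..t} (\<lambda>u. a (X u \<omega>))"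
      using st elim by (intro Henstock_Kurzweil_Integration.integral_combine integrable_continuous_real a_path_continuous) auto
    moreover have "X s \<omega> = x0 + integral {0..s} (\<lambda>s. a (X s \<omega>)) + \<sigma> * B s \<omega>"
      "X t \<omega> = x0 + integral {0..t} (\<lambda>s. a (X s \<omega>)) + \<sigma> * B t \<omega>"
      using elim st by auto
    ultimately show "X t \<omega> - X s \<omega> = integral {s..t} (\<lambda>u. a (X u \<omega>)) + \<sigma> * (B t \<omega> - B s \<omega>)"
      by (simp add: right_diff_distrib)
  qed
qed

text \<open>The noise determines the order H; the drift, of order t - s, is absorbed through (t - s)
  \<le> T^(1-H) (t - s)^H.\<close>

lemma X_increment_moment_le:
  assumes st: "0 \<le> s" "s \<le> t" "t \<le> T"
  shows "moment_le M 4 (increment_const * (t - s) powr H) (\<lambda>\<omega>. X t \<omega> - X s \<omega>)"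
proof (rule moment_le_mono_AE)
  show "moment_le M 4 ((t - s) * drift_const + \<bar>\<sigma>\<bar> * (2 * (t - s) powr H))
    (\<lambda>\<omega>. integral {s..t} (\<lambda>u. a (X u \<omega>)) + \<sigma> * (B t \<omega> - B s \<omega>))"
    by (intro moment_le_add moment_le_cmult drift_integral_moment_le B_increment_moment_le st) auto
  show "AE \<omega> in M. \<bar>X t \<omega> - X s \<omega>\<bar> \<le> \<bar>integral {s..t} (\<lambda>u. a (X u \<omega>)) + \<sigma> * (B t \<omega> - B s \<omega>)\<bar>"
    using X_increment_AE by eventually_elim (use st in auto)
  have "(t - s) * drift_const \<le> (T powr (1 - H) * (t - s) powr H) * drift_const"
  proof (intro mult_right_mono)
    have "t - s = (t - s) powr (1 - H) * (t - s) powr H"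
      using st by (cases "t = s") (auto simp flip: powr_add)
    also have "\<dots> \<le> T powr (1 - H) * (t - s) powr H"
      using st H by (intro mult_right_mono powr_mono2) auto
    finally show "t - s \<le> T powr (1 - H) * (t - s) powr H" .
  qed (rule const_nonneg)
  then show "(t - s) * drift_const + \<bar>\<sigma>\<bar> * (2 * (t - s) powr H) \<le> increment_const * (t - s) powr H"
    by (simp add: increment_const_def algebra_simps)
qed

end

section \<open>The Euler scheme\<close>

text \<open>Since h may exceed 1 on coarse grids, a surplus power of h cannot just be dropped; h
  \<le> T turns it into a constant.\<close>

lemma powr_split_le:
  fixes h T p q :: real
  assumes "0 < h" "h \<le> T" "q \<le> p"
  shows "h powr p \<le> T powr (p - q) * h powr q"
proof -
  have "h powr p = h powr (p - q) * h powr q" by (simp flip: powr_add)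
  also have "\<dots> \<le> T powr (p - q) * h powr q"
    using assms by (intro mult_right_mono powr_mono2) auto
  finally show ?thesis .
qed

text \<open>Fixing r makes the increments over [t_k, t_k + r] non-overlapping and of equal length,
  as the covariance argument requires. Expanding \<open>a\<close> at X(t_k) and inserting the
  equation for X gives a noise, a drift and a Taylor sum. The quotient by h reflects the number of
  steps and disappears on integrating r over [0, h].\<close>

lemma (in fbm_sde) drift_increments_moment_le:
  assumes n: "0 < n" and h: "h = T / real n" and r: "r \<in> {0..h}" and m: "1 \<le> m" "m \<le> n"
  shows "moment_le M 2 (remainder_const * h powr (2 * H) / h)
    (\<lambda>\<omega>. \<Sum>k<m. a (X (real k * h + r) \<omega>) - a (X (real k * h) \<omega>))"
proof -
  have h0: "0 < h" "real n * h = T" using n T by (auto simp: h)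
  have hT: "h \<le> T" using n T by (simp add: h divide_le_eq mult_le_cancel_left1)
  have grid: "0 \<le> real k * h" "real k * h + r \<le> T" "real k * h + h \<le> T" "real k * h \<le> T" if "k < n" for k
  proof -
    have "real (Suc k) * h \<le> real n * h"
      using that h0 by (intro mult_right_mono) auto
    then have "real k * h + h \<le> T" using h0 by (simp add: algebra_simps)
    then show "0 \<le> real k * h" "real k * h + r \<le> T" "real k * h + h \<le> T" "real k * h \<le> T"
      using r h0 by auto
  qed
  have rH: "r powr H \<le> h powr H" using r H by (intro powr_mono2) auto
  note K = const_nonneg
  define w where "w k \<omega> = a' (X (real k * h) \<omega>)" for k :: nat and \<omega>
  define d where "d k \<omega> = B (real k * h + r) \<omega> - B (real k * h) \<omega>" for k :: nat and \<omega>
  \<comment> \<open>In terms of step counts the weights are H-Hoelder in L4 with constant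
    \<open>P\<close>, because t_j - t_i = (j - i) h; \<open>Q\<close> is the L4 size of a single
    noise increment, with the factor 2 from the Gaussian moment bound.\<close>
  define P where "P = L2 * (increment_const * h powr H)"
  define Q where "Q = 2 * h powr H"
  define \<gamma> where "\<gamma> = 1 - 2 powr (H - 1 / 2)"
  have \<gamma>: "0 < \<gamma>" using H powr_less_mono[of "H - 1 / 2" 0 "2::real"] by (auto simp: \<gamma>_def)
  have S1: "moment_le M 2 (P * Q / \<gamma> * real m + L1 * (Q * sqrt (real m))) (\<lambda>\<omega>. \<Sum>k<m. w k \<omega> * d k \<omega>)"
    unfolding \<gamma>_def
  proof (rule weighted_sum_moment_le[OF H(2) _ _ _ _ _ m])
    show "0 \<le> P" "0 \<le> Q" using L K by (auto simp: P_def Q_def)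
  next
    fix i j :: nat assume ij: "i \<le> j" "j < n"
    have le: "real i * h \<le> real j * h" using ij h0 by (intro mult_right_mono) auto
    show "moment_le M 4 (P * real (j - i) powr H) (\<lambda>\<omega>. w j \<omega> - w i \<omega>)"
    proof (rule moment_le_mono_AE)
      show "moment_le M 4 (\<bar>L2\<bar> * (increment_const * (real j * h - real i * h) powr H))
        (\<lambda>\<omega>. L2 * (X (real j * h) \<omega> - X (real i * h) \<omega>))"
        using grid[OF ij(2)] h0 le by (intro moment_le_cmult X_increment_moment_le) auto
      show "AE \<omega> in M. \<bar>w j \<omega> - w i \<omega>\<bar> \<le> \<bar>L2 * (X (real j * h) \<omega> - X (real i * h) \<omega>)\<bar>"
        using L a'_lipschitz by (auto simp: w_def abs_mult)
      have "real j * h - real i * h = real (j - i) * h"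
        using ij by (simp add: of_nat_diff algebra_simps)
      then show "\<bar>L2\<bar> * (increment_const * (real j * h - real i * h) powr H) \<le> P * real (j - i) powr H"
        using L h0 by (simp add: P_def powr_mult mult_ac)
    qed
  next
    show "moment_le M 4 L1 (w 0)"
      by (rule moment_le_mono_AE[OF moment_le_const[OF prob, of 4 L1]])
         (use L a'_bound in \<open>auto simp: w_def\<close>)
  next
    fix i j :: nat assume ij: "i \<le> j" "j \<le> n"
    show "moment_le M 4 (Q * sqrt (real (j - i))) (\<lambda>\<omega>. \<Sum>k = i..<j. d k \<omega>)"
      unfolding d_def
    proof (rule moment_le_mono[OF fbm_increments_moment_le[OF prob fbm H]])
      fix k assume "k \<in> {i..<j}"
      then show "0 \<le> real k * h \<and> real k * h + r \<le> T" using grid[of k] ij by auto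
    next
      fix k l :: nat assume "k < l"
      then have "real (Suc k) * h \<le> real l * h" using h0 by (intro mult_right_mono) auto
      then show "real k * h + r \<le> real l * h" using r by (simp add: algebra_simps)
    next
      have "sqrt (real (j - i)) * r powr H \<le> sqrt (real (j - i)) * h powr H"
        by (intro mult_left_mono rH) auto
      then show "2 * (sqrt (real (card {i..<j})) * r powr H) \<le> Q * sqrt (real (j - i))"
        by (simp add: Q_def mult_ac)
    qed (use r in auto)
  qed
  \<comment> \<open>Drift terms are of order h and Taylor terms of order h^(2H), so for both sums
    the triangle inequality over the steps suffices.\<close>
  have S2: "moment_le M 2 (\<Sum>k<m. L1 * (h * drift_const))
      (\<lambda>\<omega>. \<Sum>k<m. w k \<omega> * integral {real k * h..real k * h + r} (\<lambda>u. a (X u \<omega>)))"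
  proof (intro moment_le_sum)
    fix k assume "k \<in> {..<m}"
    then have k: "k < n" using m by auto
    have "moment_le M 4 (\<bar>L1\<bar> * ((real k * h + r - real k * h) * drift_const))
      (\<lambda>\<omega>. L1 * integral {real k * h..real k * h + r} (\<lambda>u. a (X u \<omega>)))"
      using r grid[OF k] by (intro moment_le_cmult drift_integral_moment_le) auto
    from moment_le_4_imp_2[OF prob this]
    show "moment_le M 2 (L1 * (h * drift_const)) (\<lambda>\<omega>. w k \<omega> * integral {real k * h..real k * h + r} (\<lambda>u. a (X u \<omega>)))"
    proof (rule moment_le_mono_AE)
      show "AE \<omega> in M. \<bar>w k \<omega> * integral {real k * h..real k * h + r} (\<lambda>u. a (X u \<omega>))\<bar>
          \<le> \<bar>L1 * integral {real k * h..real k * h + r} (\<lambda>u. a (X u \<omega>))\<bar>"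
        unfolding abs_mult w_def using a'_bound L by (intro AE_I2 mult_right_mono) auto
      have "r * drift_const \<le> h * drift_const" using r K by (intro mult_right_mono) auto
      then have "L1 * (r * drift_const) \<le> L1 * (h * drift_const)" using L by (intro mult_left_mono) auto
      then show "\<bar>L1\<bar> * ((real k * h + r - real k * h) * drift_const) \<le> L1 * (h * drift_const)"
        using L by simp
    qed
  qed auto
  have S3: "moment_le M 2 (\<Sum>k<m. L2 * (increment_const * h powr H)\<^sup>2)
      (\<lambda>\<omega>. \<Sum>k<m. a (X (real k * h + r) \<omega>) - a (X (real k * h) \<omega>)
        - w k \<omega> * (X (real k * h + r) \<omega> - X (real k * h) \<omega>))"
  proof (intro moment_le_sum)
    fix k assume "k \<in> {..<m}"
    then have k: "k < n" using m by auto
    have "moment_le M 2 (\<bar>L2\<bar> * (increment_const * (real k * h + r - real k * h) powr H)\<^sup>2)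
      (\<lambda>\<omega>. L2 * (X (real k * h + r) \<omega> - X (real k * h) \<omega>)\<^sup>2)"
      using r grid[OF k] by (intro moment_le_cmult moment_le_square X_increment_moment_le) auto
    then show "moment_le M 2 (L2 * (increment_const * h powr H)\<^sup>2)
      (\<lambda>\<omega>. a (X (real k * h + r) \<omega>) - a (X (real k * h) \<omega>)
        - w k \<omega> * (X (real k * h + r) \<omega> - X (real k * h) \<omega>))"
    proof (rule moment_le_mono_AE)
      show "AE \<omega> in M. \<bar>a (X (real k * h + r) \<omega>) - a (X (real k * h) \<omega>)
        - w k \<omega> * (X (real k * h + r) \<omega> - X (real k * h) \<omega>)\<bar> \<le> \<bar>L2 * (X (real k * h + r) \<omega> - X (real k * h) \<omega>)\<^sup>2\<bar>"
        unfolding w_def using a_taylor L by (simp add: abs_mult)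
      have "(increment_const * r powr H)\<^sup>2 \<le> (increment_const * h powr H)\<^sup>2"
        using rH K by (intro power_mono mult_left_mono) auto
      then show "\<bar>L2\<bar> * (increment_const * (real k * h + r - real k * h) powr H)\<^sup>2 \<le> L2 * (increment_const * h powr H)\<^sup>2"
        using L by (simp add: mult_left_mono)
    qed
  qed auto
  let ?K = "\<bar>\<sigma>\<bar> * (P * Q / \<gamma> * real m + L1 * (Q * sqrt (real m))) + (\<Sum>k<m. L1 * (h * drift_const))
     + (\<Sum>k<m. L2 * (increment_const * h powr H)\<^sup>2)"
  have "moment_le M 2 ?K
    (\<lambda>\<omega>. \<sigma> * (\<Sum>k<m. w k \<omega> * d k \<omega>)
      + (\<Sum>k<m. w k \<omega> * integral {real k * h..real k * h + r} (\<lambda>u. a (X u \<omega>)))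
      + (\<Sum>k<m. a (X (real k * h + r) \<omega>) - a (X (real k * h) \<omega>)
        - w k \<omega> * (X (real k * h + r) \<omega> - X (real k * h) \<omega>)))"
    by (intro moment_le_add moment_le_cmult S1 S2 S3) auto
  then show ?thesis
  proof (rule moment_le_mono_AE)
    show "AE \<omega> in M. \<bar>\<Sum>k<m. a (X (real k * h + r) \<omega>) - a (X (real k * h) \<omega>)\<bar>
       \<le> \<bar>\<sigma> * (\<Sum>k<m. w k \<omega> * d k \<omega>)
      + (\<Sum>k<m. w k \<omega> * integral {real k * h..real k * h + r} (\<lambda>u. a (X u \<omega>)))
      + (\<Sum>k<m. a (X (real k * h + r) \<omega>) - a (X (real k * h) \<omega>)
        - w k \<omega> * (X (real k * h + r) \<omega> - X (real k * h) \<omega>))\<bar>"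
      using X_increment_AE
    proof eventually_elim
      case (elim \<omega>)
      have "X (real k * h + r) \<omega> - X (real k * h) \<omega> =
        integral {real k * h..real k * h + r} (\<lambda>u. a (X u \<omega>)) + \<sigma> * d k \<omega>" if "k < m" for k
        using elim grid[of k] that r m unfolding d_def by auto
      then have "(\<Sum>k<m. a (X (real k * h + r) \<omega>) - a (X (real k * h) \<omega>)) =
        (\<Sum>k<m. \<sigma> * (w k \<omega> * d k \<omega>)
          + w k \<omega> * integral {real k * h..real k * h + r} (\<lambda>u. a (X u \<omega>))
          + (a (X (real k * h + r) \<omega>) - a (X (real k * h) \<omega>)
             - w k \<omega> * (X (real k * h + r) \<omega> - X (real k * h) \<omega>)))"
        by (intro sum.cong) (auto simp: algebra_simps)
      then show ?case by (simp add: sum.distrib sum_distrib_left)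
    qed
    \<comment> \<open>The four contributions to \<open>?K\<close> are estimated after multiplication
      by h, which lets m h \<le> T absorb the number of steps.\<close>
    have mh: "real m * h \<le> T"
      using m h0 by (metis mult_right_mono of_nat_mono less_imp_le)
    have hH2: "h powr H * h powr H = h powr (2 * H)"
      by (simp flip: powr_add)
    have "P * Q / \<gamma> * (real m * h) \<le> P * Q / \<gamma> * T"
      using mh \<gamma> L K by (intro mult_left_mono) (auto simp: P_def Q_def)
    also have "\<dots> = 2 * L2 * increment_const * T / \<gamma> * h powr (2 * H)"
      unfolding P_def Q_def hH2[symmetric] by (simp add: mult_ac)
    finally have 1: "P * Q / \<gamma> * (real m * h) \<le> 2 * L2 * increment_const * T / \<gamma> * h powr (2 * H)" .
    \<comment> \<open>One half power of h pays for sqrt m; the other still exceeds h^H in order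
      because H < 1/2.\<close>
    have "sqrt (real m) * h = sqrt (real m * h) * sqrt h"
      using h0 by (simp add: real_sqrt_mult)
    also have "\<dots> \<le> sqrt T * (T powr (1 / 2 - H) * h powr H)"
      using powr_split_le[OF h0(1) hT, of H "1 / 2"] H mh h0 T
      by (intro mult_mono) (auto simp: powr_half_sqrt)
    also have "\<dots> = T powr (1 - H) * h powr H"
      using T by (simp add: powr_half_sqrt[symmetric] mult.assoc[symmetric] flip: powr_add)
    finally have "2 * L1 * h powr H * (sqrt (real m) * h) \<le> 2 * L1 * h powr H * (T powr (1 - H) * h powr H)"
      using L by (intro mult_left_mono) auto
    then have 2: "L1 * (Q * sqrt (real m)) * h \<le> 2 * L1 * T powr (1 - H) * h powr (2 * H)"
      unfolding Q_def hH2[symmetric] by (simp add: mult_ac)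
    have "real m * h * h \<le> T * (T powr (1 - 2 * H) * h powr (2 * H))"
      using powr_split_le[OF h0(1) hT, of "2 * H" 1] H mh h0 T
      by (intro mult_mono) auto
    then have "L1 * drift_const * (real m * h * h) \<le> L1 * drift_const * (T * (T powr (1 - 2 * H) * h powr (2 * H)))"
      using L K by (intro mult_left_mono) auto
    then have 3: "(\<Sum>k<m. L1 * (h * drift_const)) * h \<le> L1 * drift_const * T * T powr (1 - 2 * H) * h powr (2 * H)"
      by (simp add: mult_ac)
    have "L2 * increment_const\<^sup>2 * h powr (2 * H) * (real m * h) \<le> L2 * increment_const\<^sup>2 * h powr (2 * H) * T"
      using L mh by (intro mult_left_mono) auto
    then have 4: "(\<Sum>k<m. L2 * (increment_const * h powr H)\<^sup>2) * h \<le> L2 * increment_const\<^sup>2 * T * h powr (2 * H)"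
      unfolding hH2[symmetric] by (simp add: power_mult_distrib power2_eq_square mult_ac)
    have "\<bar>\<sigma>\<bar> * (P * Q / \<gamma> * (real m * h) + L1 * (Q * sqrt (real m)) * h)
        \<le> \<bar>\<sigma>\<bar> * (2 * L2 * increment_const * T / \<gamma> * h powr (2 * H) + 2 * L1 * T powr (1 - H) * h powr (2 * H))"
      using 1 2 by (intro mult_left_mono add_mono) auto
    then have "?K * h \<le> remainder_const * h powr (2 * H)"
      using 3 4 unfolding remainder_const_def \<gamma>_def[symmetric]
      by (simp only: distrib_right distrib_left mult.assoc)
    then show "?K \<le> remainder_const * h powr (2 * H) / h"
      using h0 by (simp add: le_divide_eq)
  qed
qed

text \<open>The error at \<open>t \<in> (t\<^sub>k, t\<^sub>k\<^sub>+\<^sub>1]\<close> is measured against the exact drift frozen at the grid points of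
  \<open>X\<close>, not of \<open>Y\<close>, so that the remainder depends on \<open>X\<close> only.\<close>

lemma (in fbm_sde) euler_error_AE:
  assumes n: "0 < n" and h: "h = T / real n" and Y: "euler_scheme M a \<sigma> x0 T n B Y"
  shows "AE \<omega> in M. X 0 \<omega> = Y 0 \<omega> \<and> (\<forall>k<n. \<forall>s. 0 < s \<longrightarrow> s \<le> h \<longrightarrow>
    X (real k * h + s) \<omega> - Y (real k * h + s) \<omega> =
      (X (real k * h) \<omega> - Y (real k * h) \<omega>) + s * (a (X (real k * h) \<omega>) - a (Y (real k * h) \<omega>))
      + integral {0..s} (\<lambda>r. a (X (real k * h + r) \<omega>) - a (X (real k * h) \<omega>)))"
  using paths_AE X_increment_AE AE_space
proof eventually_elim
  case (elim \<omega>)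
  have h0: "0 < h" "real n * h = T" using n T by (auto simp: h)
  \<comment> \<open>The recursion for \<open>Y\<close> is available only on \<open>space M\<close>,
    which is why \<open>AE_space\<close> joins the almost sure facts.\<close>
  have Y0: "Y 0 \<omega> = x0" and Yt: "\<And>k t. k < n \<Longrightarrow> t \<in> {real k * h<..real (Suc k) * h} \<Longrightarrow>
      Y t \<omega> = Y (real k * h) \<omega> + a (Y (real k * h) \<omega>) * (t - real k * h) + \<sigma> * (B t \<omega> - B (real k * h) \<omega>)"
    using Y elim(3) unfolding euler_scheme_def Let_def h by auto
  have "X 0 \<omega> = x0" using elim(1) T by auto
  moreover
  { fix k s assume k: "k < n" and s: "0 < s" "s \<le> h"
    let ?t = "real k * h"
    have "real (Suc k) * h \<le> real n * h"
      using k h0 by (intro mult_right_mono) auto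
    then have t: "0 \<le> ?t" "?t + s \<le> T" using h0 s by (auto simp: algebra_simps)
    have "Y (?t + s) \<omega> = Y ?t \<omega> + a (Y ?t \<omega>) * s + \<sigma> * (B (?t + s) \<omega> - B ?t \<omega>)"
      using Yt[OF k, of "?t + s"] s by (simp add: algebra_simps)
    moreover have "X (?t + s) \<omega> - X ?t \<omega> = integral {?t..?t + s} (\<lambda>u. a (X u \<omega>)) + \<sigma> * (B (?t + s) \<omega> - B ?t \<omega>)"
      using elim(2) t s by auto
    \<comment> \<open>Shifting to an interval starting at 0 gives all steps the same domain of
      integration, so that the sum over k can later be taken under one integral.\<close>
    moreover have "integral {?t..?t + s} (\<lambda>u. a (X u \<omega>)) = integral {0..s} (\<lambda>r. a (X (?t + r) \<omega>))"
      using integral_shift_Icc_real[of 0 s "\<lambda>u. a (X u \<omega>)" ?t] by (simp add: o_def add.commute)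
    moreover have "integral {0..s} (\<lambda>r. a (X (?t + r) \<omega>) - a (X ?t \<omega>)) =
        integral {0..s} (\<lambda>r. a (X (?t + r) \<omega>)) - s * a (X ?t \<omega>)"
    proof -
      have "continuous_on {0..s} (\<lambda>r. a (X (?t + r) \<omega>))"
        by (rule continuous_on_compose2[OF a_path_continuous[of \<omega> 0 T]])
           (use elim t T in \<open>auto intro!: continuous_intros\<close>)
      then show ?thesis
        using s by (subst Henstock_Kurzweil_Integration.integral_diff) (auto intro: integrable_continuous_real)
    qed
    ultimately have "X (?t + s) \<omega> - Y (?t + s) \<omega> =
      (X ?t \<omega> - Y ?t \<omega>) + s * (a (X ?t \<omega>) - a (Y ?t \<omega>))
      + integral {0..s} (\<lambda>r. a (X (?t + r) \<omega>) - a (X ?t \<omega>))"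
      by (simp add: algebra_simps) }
  ultimately show ?case using Y0 by simp
qed

text \<open>The sequence c (1 + q)^m satisfies the summed error recursion with equality, so it is
  exactly the bound that a strong induction reproduces.\<close>

lemma sum_geometric_gronwall:
  fixes c q :: real
  shows "c + q * (\<Sum>k<m. c * (1 + q) ^ k) = c * (1 + q) ^ m"
  by (induction m) (simp_all add: algebra_simps)

text \<open>The recursion is unrolled before norms are taken, since a one-step induction would bound
  each local error separately and lose the cancellation. The unrolled form involves all earlier
  errors, hence the strong induction.\<close>

lemma (in fbm_sde) euler_grid_moment_le:
  assumes n: "0 < n" and h: "h = T / real n" and Y: "euler_scheme M a \<sigma> x0 T n B Y"
  shows "m \<le> n \<Longrightarrow> moment_le M 2 (remainder_const * h powr (2 * H) * (1 + L1 * h) ^ m)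
    (\<lambda>\<omega>. X (real m * h) \<omega> - Y (real m * h) \<omega>)"
proof (induction m rule: less_induct)
  case (less m)
  have h0: "0 < h" "real n * h = T" using n T by (auto simp: h)
  let ?c = "remainder_const * h powr (2 * H)"
  let ?e = "\<lambda>k \<omega>. X (real k * h) \<omega> - Y (real k * h) \<omega>"
  let ?D = "\<lambda>k \<omega> r. a (X (real k * h + r) \<omega>) - a (X (real k * h) \<omega>)"
  have c: "0 \<le> ?c" using const_nonneg by simp
  have cont: "continuous_on {0..h} (?D k \<omega>)" if "continuous_on {0..T} (\<lambda>t. X t \<omega>)" "k < n" for k \<omega>
  proof -
    have "real (Suc k) * h \<le> real n * h"
      using that h0 by (intro mult_right_mono) auto
    then have "real k * h + h \<le> T" using h0 by (simp add: algebra_simps)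
    then have "continuous_on {0..h} (\<lambda>r. a (X (real k * h + r) \<omega>))"
      by (intro continuous_on_compose2[OF a_path_continuous[of \<omega> 0 T]])
         (use that h0 in \<open>auto intro!: continuous_intros\<close>)
    then show ?thesis by (intro continuous_intros)
  qed
  show ?case
  proof (cases "m = 0")
    case True
    have "AE \<omega> in M. ?e 0 \<omega> = 0"
      using euler_error_AE[OF assms] by eventually_elim simp
    then show ?thesis using True c by (intro moment_le_zero) auto
  next
    case False
    \<comment> \<open>The moment bound is applied to the whole sum over k under the integral; the
      length h of the interval cancels the quotient.\<close>
    have "moment_le M 2 ((h - 0) * (?c / h)) (\<lambda>\<omega>. integral {0..h} (\<lambda>r. \<Sum>k<m. ?D k \<omega> r))"
    proof (intro moment_le_integral drift_increments_moment_le[OF n h])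
      show "AE \<omega> in M. continuous_on {0..h} (\<lambda>r. \<Sum>k<m. ?D k \<omega> r)"
        using paths_AE
      proof eventually_elim
        case (elim \<omega>)
        then show ?case using less.prems by (intro continuous_on_sum cont) auto
      qed
    qed (use less.prems False h0 in auto)
    then have R: "moment_le M 2 ?c (\<lambda>\<omega>. integral {0..h} (\<lambda>r. \<Sum>k<m. ?D k \<omega> r))"
      using h0 by simp
    have E: "moment_le M 2 (L1 * (?c * (1 + L1 * h) ^ k)) (\<lambda>\<omega>. a (X (real k * h) \<omega>) - a (Y (real k * h) \<omega>))"
      if "k < m" for k
    proof (rule moment_le_mono_AE[OF moment_le_cmult[OF less.IH[OF that], of L1]])
      show "AE \<omega> in M. \<bar>a (X (real k * h) \<omega>) - a (Y (real k * h) \<omega>)\<bar> \<le> \<bar>L1 * ?e k \<omega>\<bar>"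
        using a_lipschitz L by (simp add: abs_mult)
    qed (use that less.prems L in auto)
    have "moment_le M 2 (?c + \<bar>h\<bar> * (\<Sum>k<m. L1 * (?c * (1 + L1 * h) ^ k)))
      (\<lambda>\<omega>. integral {0..h} (\<lambda>r. \<Sum>k<m. ?D k \<omega> r) + h * (\<Sum>k<m. a (X (real k * h) \<omega>) - a (Y (real k * h) \<omega>)))"
      by (intro moment_le_add R moment_le_cmult moment_le_sum E) auto
    then show ?thesis
    proof (rule moment_le_mono_AE)
      show "AE \<omega> in M. \<bar>?e m \<omega>\<bar> \<le> \<bar>integral {0..h} (\<lambda>r. \<Sum>k<m. ?D k \<omega> r)
          + h * (\<Sum>k<m. a (X (real k * h) \<omega>) - a (Y (real k * h) \<omega>))\<bar>"
        using euler_error_AE[OF assms] paths_AE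
      proof eventually_elim
        case (elim \<omega>)
        have "integral {0..h} (\<lambda>r. \<Sum>k<m. ?D k \<omega> r) = (\<Sum>k<m. integral {0..h} (?D k \<omega>))"
          using elim less.prems by (intro Henstock_Kurzweil_Integration.integral_sum integrable_continuous_real cont) auto
        moreover have "j \<le> n \<Longrightarrow> ?e j \<omega> = (\<Sum>k<j. integral {0..h} (?D k \<omega>))
            + h * (\<Sum>k<j. a (X (real k * h) \<omega>) - a (Y (real k * h) \<omega>))" for j
        proof (induction j)
          case (Suc j)
          have "real (Suc j) * h = real j * h + h" by (simp add: algebra_simps)
          then have "?e (Suc j) \<omega> = ?e j \<omega> + h * (a (X (real j * h) \<omega>) - a (Y (real j * h) \<omega>))
              + integral {0..h} (?D j \<omega>)"
            using elim(1) h0 Suc.prems by simp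
          then show ?case using Suc by (simp add: distrib_left)
        qed (use elim in simp)
        ultimately show ?case using less.prems by simp
      qed
      have "\<bar>h\<bar> * (\<Sum>k<m. L1 * (?c * (1 + L1 * h) ^ k)) = L1 * h * (\<Sum>k<m. ?c * (1 + L1 * h) ^ k)"
        using h0 by (simp add: sum_distrib_left mult_ac)
      then show "?c + \<bar>h\<bar> * (\<Sum>k<m. L1 * (?c * (1 + L1 * h) ^ k)) \<le> ?c * (1 + L1 * h) ^ m"
        using sum_geometric_gronwall[of ?c "L1 * h" m] by simp
    qed
  qed
qed

text \<open>From the last grid point to t there is a single partial step, whose local error of order
  h^(1+H) is harmless without cancellation, as 1 + H \<ge> 2H. Measurability of \<open>Y\<close> is
  not assumed but propagated along the recursion.\<close>

lemma (in fbm_sde) euler_moment_le: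
  assumes n: "0 < n" and h: "h = T / real n" and Y: "euler_scheme M a \<sigma> x0 T n B Y"
    and t: "t \<in> {0..T}"
  shows "moment_le M 2 (error_const * h powr (2 * H)) (\<lambda>\<omega>. X t \<omega> - Y t \<omega>)"
    and "Y t \<in> borel_measurable M"
proof -
  have h0: "0 < h" "real n * h = T" using n T by (auto simp: h)
  have hT: "h \<le> T" using n T by (simp add: h divide_le_eq mult_le_cancel_left1)
  have a_borel [measurable]: "a \<in> borel_measurable borel"
    using a_continuous[of UNIV] by (rule borel_measurable_continuous_onI)
  have Y0: "Y 0 \<omega> = x0" and Yt: "\<And>k t. k < n \<Longrightarrow> t \<in> {real k * h<..real (Suc k) * h} \<Longrightarrow>
      Y t \<omega> = Y (real k * h) \<omega> + a (Y (real k * h) \<omega>) * (t - real k * h) + \<sigma> * (B t \<omega> - B (real k * h) \<omega>)"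
    if "\<omega> \<in> space M" for \<omega>
    using Y that unfolding euler_scheme_def Let_def h by auto
  have grid: "0 \<le> real k * h" "real k * h + h \<le> T" if "k < n" for k
  proof -
    have "real (Suc k) * h \<le> real n * h"
      using that h0 by (intro mult_right_mono) auto
    then show "0 \<le> real k * h" "real k * h + h \<le> T" using h0 by (auto simp: algebra_simps)
  qed
  have step_meas: "Y (real k * h + s) \<in> borel_measurable M"
    if "k < n" "0 < s" "s \<le> h" "Y (real k * h) \<in> borel_measurable M" for k s
  proof -
    have [measurable]: "B (real k * h + s) \<in> borel_measurable M" "B (real k * h) \<in> borel_measurable M"
      "Y (real k * h) \<in> borel_measurable M"
      using that grid[of k] by (auto intro!: B_measurable)
    have "(\<lambda>\<omega>. Y (real k * h) \<omega> + a (Y (real k * h) \<omega>) * s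
        + \<sigma> * (B (real k * h + s) \<omega> - B (real k * h) \<omega>)) \<in> borel_measurable M"
      by measurable
    also have "?this \<longleftrightarrow> ?thesis"
      using that by (intro measurable_cong) (simp add: Yt[where k = k] algebra_simps)
    finally show ?thesis .
  qed
  have Y0_meas: "Y 0 \<in> borel_measurable M"
    using measurable_cong[of M "Y 0" "\<lambda>_. x0" borel] Y0 by simp
  have grid_meas: "k \<le> n \<Longrightarrow> Y (real k * h) \<in> borel_measurable M" for k
  proof (induction k)
    case (Suc k)
    have "real (Suc k) * h = real k * h + h" by (simp add: algebra_simps)
    then show ?case using step_meas[of k h] Suc h0 by simp
  qed (simp add: Y0_meas)
  have "moment_le M 2 (error_const * h powr (2 * H)) (\<lambda>\<omega>. X t \<omega> - Y t \<omega>) \<and> Y t \<in> borel_measurable M"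
  proof (cases "t = 0")
    case True
    have "AE \<omega> in M. X 0 \<omega> - Y 0 \<omega> = 0"
      using euler_error_AE[OF assms(1-3)] by eventually_elim simp
    then have "moment_le M 2 (error_const * h powr (2 * H)) (\<lambda>\<omega>. X 0 \<omega> - Y 0 \<omega>)"
      using const_nonneg by (intro moment_le_zero) auto
    then show ?thesis using True Y0_meas by simp
  next
    case False
    \<comment> \<open>The steps are open on the left, so a grid point belongs to the step that ends
      there: ceiling minus one, and t = 0 apart.\<close>
    define k where "k = nat (\<lceil>t / h\<rceil> - 1)"
    define s where "s = t - real k * h"
    have "0 < t / h" using False t h0 by simp
    then have k: "real k < t / h" "t / h \<le> real k + 1"
      unfolding k_def by linarith+
    have "t / h \<le> real n" using t h0 by (simp add: divide_le_eq)
    then have kn: "k < n" using k(1) by linarith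
    have s: "0 < s" "s \<le> h" "t = real k * h + s"
      using k h0 by (auto simp: s_def field_simps)
    let ?t = "real k * h" and ?p = "h powr (2 * H)"
    have pow: "(1 + L1 * h) ^ k \<le> exp (L1 * T)"
    proof -
      have "(1 + L1 * h) ^ k \<le> exp (L1 * h) ^ k"
        using L h0 by (intro power_mono) auto
      also have "\<dots> = exp (L1 * (real k * h))"
        by (simp add: exp_of_nat_mult[symmetric] mult_ac)
      also have "real k * h \<le> T" using grid(2)[OF kn] h0 by linarith
      then have "exp (L1 * (real k * h)) \<le> exp (L1 * T)"
        using L by (intro iffD2[OF exp_le_cancel_iff] mult_left_mono)
      finally show ?thesis .
    qed
    have "remainder_const * ?p * (1 + L1 * h) ^ k \<le> remainder_const * ?p * exp (L1 * T)"
      using const_nonneg pow by (intro mult_left_mono) auto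
    then have e: "moment_le M 2 (remainder_const * ?p * exp (L1 * T)) (\<lambda>\<omega>. X ?t \<omega> - Y ?t \<omega>)"
      using kn by (intro moment_le_mono[OF euler_grid_moment_le[OF assms(1-3), of k]]) auto
    have D: "moment_le M 2 (L1 * (increment_const * h powr H)) (\<lambda>\<omega>. a (X (?t + r) \<omega>) - a (X ?t \<omega>))"
      if r: "r \<in> {0..s}" for r
    proof (rule moment_le_mono_AE)
      show "moment_le M 2 (\<bar>L1\<bar> * (increment_const * (?t + r - ?t) powr H)) (\<lambda>\<omega>. L1 * (X (?t + r) \<omega> - X ?t \<omega>))"
        using r s grid[OF kn]
        by (intro moment_le_4_imp_2[OF prob] moment_le_cmult X_increment_moment_le) auto
      show "AE \<omega> in M. \<bar>a (X (?t + r) \<omega>) - a (X ?t \<omega>)\<bar> \<le> \<bar>L1 * (X (?t + r) \<omega> - X ?t \<omega>)\<bar>"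
        using a_lipschitz L by (simp add: abs_mult)
      show "\<bar>L1\<bar> * (increment_const * (?t + r - ?t) powr H) \<le> L1 * (increment_const * h powr H)"
        using L const_nonneg r s H by (auto intro!: mult_left_mono powr_mono2)
    qed
    have int: "moment_le M 2 ((s - 0) * (L1 * (increment_const * h powr H)))
        (\<lambda>\<omega>. integral {0..s} (\<lambda>r. a (X (?t + r) \<omega>) - a (X ?t \<omega>)))"
    proof (intro moment_le_integral D)
      show "AE \<omega> in M. continuous_on {0..s} (\<lambda>r. a (X (?t + r) \<omega>) - a (X ?t \<omega>))"
        using paths_AE
      proof eventually_elim
        case (elim \<omega>)
        have "continuous_on {0..s} (\<lambda>r. a (X (?t + r) \<omega>))"
          by (rule continuous_on_compose2[OF a_path_continuous[of \<omega> 0 T]])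
             (use elim grid[OF kn] s T in \<open>auto intro!: continuous_intros\<close>)
        then show ?case by (intro continuous_intros)
      qed
    qed (use s in auto)
    have da: "moment_le M 2 (L1 * (remainder_const * ?p * exp (L1 * T))) (\<lambda>\<omega>. a (X ?t \<omega>) - a (Y ?t \<omega>))"
    proof (rule moment_le_mono_AE[OF moment_le_cmult[OF e, of L1]])
      show "AE \<omega> in M. \<bar>a (X ?t \<omega>) - a (Y ?t \<omega>)\<bar> \<le> \<bar>L1 * (X ?t \<omega> - Y ?t \<omega>)\<bar>"
        using a_lipschitz L by (simp add: abs_mult)
    qed (use L in auto)
    have "moment_le M 2 (remainder_const * ?p * exp (L1 * T) + \<bar>s\<bar> * (L1 * (remainder_const * ?p * exp (L1 * T)))
        + (s - 0) * (L1 * (increment_const * h powr H)))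
      (\<lambda>\<omega>. (X ?t \<omega> - Y ?t \<omega>) + s * (a (X ?t \<omega>) - a (Y ?t \<omega>))
        + integral {0..s} (\<lambda>r. a (X (?t + r) \<omega>) - a (X ?t \<omega>)))"
      by (intro moment_le_add moment_le_cmult e da int) auto
    then have "moment_le M 2 (error_const * ?p) (\<lambda>\<omega>. X t \<omega> - Y t \<omega>)"
    proof (rule moment_le_mono_AE)
      show "AE \<omega> in M. \<bar>X t \<omega> - Y t \<omega>\<bar> \<le> \<bar>(X ?t \<omega> - Y ?t \<omega>) + s * (a (X ?t \<omega>) - a (Y ?t \<omega>))
        + integral {0..s} (\<lambda>r. a (X (?t + r) \<omega>) - a (X ?t \<omega>))\<bar>"
        using euler_error_AE[OF assms(1-3)] by eventually_elim (use kn s in auto)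
      have "s * h powr H \<le> h powr (1 + H)"
        using s h0 by (simp add: powr_add mult_right_mono)
      also have "\<dots> \<le> T powr (1 - H) * ?p"
        using powr_split_le[OF h0(1) hT, of "2 * H" "1 + H"] H by (simp add: algebra_simps)
      finally have "L1 * increment_const * (s * h powr H) \<le> L1 * increment_const * (T powr (1 - H) * ?p)"
        using L const_nonneg by (intro mult_left_mono) auto
      moreover have "s * (L1 * (remainder_const * ?p * exp (L1 * T))) \<le> T * (L1 * (remainder_const * ?p * exp (L1 * T)))"
        using L const_nonneg s hT by (intro mult_right_mono) auto
      ultimately show "remainder_const * ?p * exp (L1 * T) + \<bar>s\<bar> * (L1 * (remainder_const * ?p * exp (L1 * T)))
        + (s - 0) * (L1 * (increment_const * h powr H)) \<le> error_const * ?p"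
        using s by (simp add: error_const_def algebra_simps)
    qed
    moreover have "Y t \<in> borel_measurable M"
      using step_meas[OF kn s(1,2) grid_meas] kn s(3) by simp
    ultimately show ?thesis ..
  qed
  then show "moment_le M 2 (error_const * h powr (2 * H)) (\<lambda>\<omega>. X t \<omega> - Y t \<omega>)" "Y t \<in> borel_measurable M"
    by auto
qed

text \<open>Integrability and boundedness are asserted along with the estimate because
  \<open>LINT\<close> and \<open>SUP\<close> are total: without them the inequality could hold
  through default values.\<close>

theorem theorem1p1:
  fixes H T \<sigma> x0 :: real and a :: "real \<Rightarrow> real"
  assumes "1 / 3 < H" and "H < 1 / 2" and "T > 0"
    and "bounded_derivs 3 a"
  shows "\<exists>C::real. \<forall>(M :: 'w measure) B X.
    prob_space M \<and> fractional_brownian_motion M H T B \<and> sde_solution M a \<sigma> x0 T B X \<longrightarrow>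
    (\<forall>(n::nat) Y. n > 0 \<and> euler_scheme M a \<sigma> x0 T n B Y \<longrightarrow>
       (\<forall>t\<in>{0..T}. integrable M (\<lambda>\<omega>. \<bar>X t \<omega> - Y t \<omega>\<bar>\<^sup>2)) \<and>
       bdd_above ((\<lambda>t. LINT \<omega>|M. \<bar>X t \<omega> - Y t \<omega>\<bar>\<^sup>2) ` {0..T}) \<and>
       sqrt (SUP t\<in>{0..T}. LINT \<omega>|M. \<bar>X t \<omega> - Y t \<omega>\<bar>\<^sup>2) \<le> C * (T / real n) powr (2 * H))"
proof -
  have "2 \<le> (3::nat)" by simp
  from bounded_derivs_imp_bounds[OF assms(4) this] obtain L1 L2 where L: "0 \<le> L1" "0 \<le> L2"
    "\<And>x y. \<bar>a x - a y\<bar> \<le> L1 * \<bar>x - y\<bar>" "\<And>x. \<bar>deriv a x\<bar> \<le> L1"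
    "\<And>x y. \<bar>deriv a x - deriv a y\<bar> \<le> L2 * \<bar>x - y\<bar>"
    "\<And>x y. \<bar>a x - a y - deriv a y * (x - y)\<bar> \<le> L2 * (x - y)\<^sup>2"
    by metis
  have "0 < H" using assms(1) by simp
  interpret c: sde_coefficients a "deriv a" H T \<sigma> x0 L1 L2
    by (rule sde_coefficients.intro) fact+
  show ?thesis
  proof (intro exI[of _ c.error_const] allI impI)
    fix M :: "'w measure" and B X and n :: nat and Y
    assume MBX: "prob_space M \<and> fractional_brownian_motion M H T B \<and> sde_solution M a \<sigma> x0 T B X"
      and nY: "n > 0 \<and> euler_scheme M a \<sigma> x0 T n B Y"
    interpret fbm_sde a "deriv a" H T \<sigma> x0 L1 L2 M B X
      by (rule fbm_sde.intro[OF c.sde_coefficients_axioms fbm_sde_axioms.intro]) (use MBX in blast)+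
    let ?K = "c.error_const * (T / real n) powr (2 * H)"
    let ?E = "\<lambda>t. LINT \<omega>|M. \<bar>X t \<omega> - Y t \<omega>\<bar>\<^sup>2"
    have bound: "integrable M (\<lambda>\<omega>. \<bar>X t \<omega> - Y t \<omega>\<bar>\<^sup>2)" "?E t \<le> ?K\<^sup>2" if "t \<in> {0..T}" for t
    proof -
      have mom: "moment_le M 2 ?K (\<lambda>\<omega>. X t \<omega> - Y t \<omega>)" and [measurable]: "Y t \<in> borel_measurable M"
        using euler_moment_le[OF _ refl _ that] nY by auto
      have [measurable]: "X t \<in> borel_measurable M" by (rule X_measurable[OF that])
      show "integrable M (\<lambda>\<omega>. \<bar>X t \<omega> - Y t \<omega>\<bar>\<^sup>2)" "?E t \<le> ?K\<^sup>2"
        using moment_le_2D[OF mom] by auto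
    qed
    have "(SUP t\<in>{0..T}. ?E t) \<le> ?K\<^sup>2"
      using bound(2) assms(3) by (intro cSUP_least) auto
    then have "sqrt (SUP t\<in>{0..T}. ?E t) \<le> ?K"
      using c.const_nonneg(6) by (intro real_le_lsqrt) auto
    moreover have "bdd_above (?E ` {0..T})"
      using bound(2) by (intro bdd_aboveI2)
    ultimately show "(\<forall>t\<in>{0..T}. integrable M (\<lambda>\<omega>. \<bar>X t \<omega> - Y t \<omega>\<bar>\<^sup>2)) \<and>
       bdd_above (?E ` {0..T}) \<and> sqrt (SUP t\<in>{0..T}. ?E t) \<le> ?K"
      using bound(1) by auto
  qed
qed

end
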